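(* Let $F\in V^{mg}_{1/2}(N,\chi)$ and let $G=F|_{\frac12}W(N)$. Then $\Lambda_N(F,s)$ (defined for $\operatorname{Re}(s)$ sufficiently large) has a meromorphic continuation to the whole complex plane, whose poles are as follows. It has simple poles at $s=-\frac12$ and $s=1$ with residues $-N^{-1/4}d_F(2)$ and $i^{1/2}N^{-1/4}d_G(2)$ respectively. Additionally it has a pole at $s=0$ and a pole at $s=\frac12$, with residues $-d_F(0)+d_F(1)\log\sqrt N$ and $i^{1/2}\left(d_G(0)-d_G(1)\log\sqrt N\right)$ respectively; the pole at $0$ is a double pole unless $d_F(1)=0$, and the pole at $\frac12$ is a double pole unless $d_G(1)=0$. (If the pole at one of these points is not double and the stated residue is $0$, there is no pole at that point.) Moreover, the functional equation $$\Lambda_N(F,s)=i^{1/2}\,\Lambda_N\left(G,\tfrac12-s\right)$$ holds.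
   Context: $N$ is a positive integer divisible by $4$, $\chi$ is a Dirichlet character modulo $N$, $\tau=u+iv\in\mathbb H$, $q=e^{2\pi i\tau}$; fractional powers use the principal branch, so $i^{1/2}=e^{\pi i/4}$. For $\gamma=\begin{pmatrix}a&b\\c&d\end{pmatrix}\in SL_2(\mathbb Z)$ put $(f|_{1/2}\gamma)(\tau)=(c\tau+d)^{-1/2}f(\gamma\tau)$; for $\gamma\in\Gamma_0(N)$, $\chi(\gamma)=\chi(d)$ and $\nu_\theta(\gamma)=(c\tau+d)^{-1/2}\theta(\gamma\tau)/\theta(\tau)$ with $\theta(\tau)=\sum_{n\in\mathbb Z}q^{n^2}$. Let $\Delta_{1/2}=-v^2(\partial_u^2+\partial_v^2)+\frac{i}{2}v(\partial_u+i\partial_v)$. $M_{1/2}(N,\chi)$ is the space of holomorphic $f:\mathbb H\to\mathbb C$ with $f|_{1/2}\gamma=\chi(\gamma)\nu_\theta(\gamma)f$ for all $\gamma\in\Gamma_0(N)$ and such that $f|_{1/2}\sigma$ has at most polynomial growth in $v$ as $v\to\infty$ for all $\sigma\in SL_2(\mathbb Z)$ (polynomial growth at all cusps). $V^{mg}_{1/2}(N,\chi)$ (weight $\frac12$ sesquiharmonic Maass forms of moderate growth) is the space of real-analytic $F:\mathbb H\to\mathbb C$ with $F|_{1/2}\gamma=\chi(\gamma)\nu_\theta(\gamma)F$ for all $\gamma\in\Gamma_0(N)$, $\Delta_{1/2}F\in M_{1/2}(N,\chi)$, and polynomial growth at all cusps. For $y>0$ let $\alpha(y)=\frac{\sqrt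 y}{4\pi}\int_0^\infty t^{-1/2}e^{-\pi yt}\log(1+t)\,dt$ and $\beta(y)=\frac1{\sqrt\pi}\int_{\pi y}^\infty t^{-1/2}e^{-t}\,dt$. Every $F\in V^{mg}_{1/2}(N,\chi)$ has a Fourier expansion $$F(\tau)=d_F(0)+d_F(1)\log v+d_F(2)v^{1/2}+\sum_{n>0}c_F(n)q^n+\sum_{n<0}b_F(n)\beta(-4nv)q^n+\sum_{n\ge1}a_F(n)\alpha(4nv)q^n ,$$ with coefficients of polynomial growth in $|n|$. The Fricke involution is $(F|_{\frac12}W(N))(\tau)=N^{1/4}(N\tau)^{-1/2}F(-1/(N\tau))$. The function $G=F|_{\frac12}W(N)$ lies in $V^{mg}_{1/2}(N,\overline\chi\left(\frac N\bullet\right))$ and has an expansion of the same form, with coefficients indicated by the subscript $G$. With $\Gamma(\nu,a)=\int_a^\infty e^{-y}y^{\nu-1}dy$, let $W_{1/2}(s)=\int_0^\infty\Gamma(\tfrac12,2x)e^xx^{s-1}dx$ for $\operatorname{Re}(s)>0$ and $Z(s)=\int_0^\infty\alpha\left(\frac{2x}\pi\right)e^{-x}x^{s-1}dx$ for $\operatorname{Re}(s)>1$. Put $L^+(F,s)=\sum_{n\ge1}c_F(n)n^{-s}$, $L^-(F,s)=\sum_{n\ge1}b_F(-n)n^{-s}$, $L^*(F,s)=\sum_{n\ge1}a_F(n)n^{-s}$ (absolutely convergent for $\operatorname{Re}(s)$ large), and $$\Lambda_N(F,s)=\left(\frac{\sqrt N}{2\pi}\right)^s\left[\Gamma(s)L^+(F,s)+\frac1{\sqrt\pi}W_{1/2}(s)L^-(F,s)+Z(s)L^*(F,s)\right],$$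 and likewise for $G$. *)

theory Defs
  imports "HOL-Complex_Analysis.Complex_Analysis"
begin

abbreviation upper_half_plane :: "complex set" ("\<H>") where
  "\<H> \<equiv> {\<tau>. Im \<tau> > 0}"

definition SL2Z :: "(int ^ 2 ^ 2) set" where
  "SL2Z = {\<gamma>. det \<gamma> = 1}"

definition Gamma0 :: "nat \<Rightarrow> (int ^ 2 ^ 2) set" where
  "Gamma0 N = {\<gamma> \<in> SL2Z. int N dvd \<gamma> $ 2 $ 1}"

definition moebius :: "int ^ 2 ^ 2 \<Rightarrow> complex \<Rightarrow> complex" where
  "moebius \<gamma> \<tau> =
     (of_int (\<gamma> $ 1 $ 1) * \<tau> + of_int (\<gamma> $ 1 $ 2)) / (of_int (\<gamma> $ 2 $ 1) * \<tau> + of_int (\<gamma> $ 2 $ 2))"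

definition aut_factor :: "int ^ 2 ^ 2 \<Rightarrow> complex \<Rightarrow> complex" where
  "aut_factor \<gamma> \<tau> = (of_int (\<gamma> $ 2 $ 1) * \<tau> + of_int (\<gamma> $ 2 $ 2)) powr (-1/2)"

definition slash_half :: "(complex \<Rightarrow> complex) \<Rightarrow> int ^ 2 ^ 2 \<Rightarrow> complex \<Rightarrow> complex" where
  "slash_half f \<gamma> \<tau> = aut_factor \<gamma> \<tau> * f (moebius \<gamma> \<tau>)"

definition qq :: "complex \<Rightarrow> complex" where
  "qq \<tau> = exp (2 * of_real pi * \<i> * \<tau>)"

definition theta :: "complex \<Rightarrow> complex" where
  "theta \<tau> = (\<Sum>\<^sub>\<infinity>n\<in>(UNIV :: int set). qq \<tau> powi (n ^ 2))"

text \<open>For \<open>4 dvd N\<close> and \<open>\<gamma> \<in> Gamma0 N\<close> the quotient does not depend on \<open>\<tau>\<close>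
  (and \<open>theta\<close> has no zeros on the upper half plane).\<close>

definition nu_theta :: "int ^ 2 ^ 2 \<Rightarrow> complex \<Rightarrow> complex" where
  "nu_theta \<gamma> \<tau> = aut_factor \<gamma> \<tau> * theta (moebius \<gamma> \<tau>) / theta \<tau>"

definition dirichlet_character :: "nat \<Rightarrow> (int \<Rightarrow> complex) \<Rightarrow> bool" where
  "dirichlet_character N chi \<longleftrightarrow>
     (\<forall>m n. chi (m * n) = chi m * chi n) \<and> (\<forall>n. chi (n + int N) = chi n) \<and>
     (\<forall>n. chi n \<noteq> 0 \<longleftrightarrow> coprime n (int N))"

definition modular_half :: "nat \<Rightarrow> (int \<Rightarrow> complex) \<Rightarrow> (complex \<Rightarrow> complex) \<Rightarrow> bool" where
  "modular_half N chi f \<longleftrightarrow>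
     (\<forall>\<gamma>\<in>Gamma0 N. \<forall>\<tau>\<in>\<H>. slash_half f \<gamma> \<tau> = chi (\<gamma> $ 2 $ 2) * nu_theta \<gamma> \<tau> * f \<tau>)"

text \<open>Growth in \<open>v = Im \<tau>\<close> is required uniformly in \<open>u = Re \<tau>\<close>.\<close>

definition poly_growth_at_cusps :: "(complex \<Rightarrow> complex) \<Rightarrow> bool" where
  "poly_growth_at_cusps f \<longleftrightarrow>
     (\<forall>\<sigma>\<in>SL2Z. \<exists>C v0 :: real. \<exists>k :: nat. v0 > 0 \<and>
        (\<forall>\<tau>. Im \<tau> \<ge> v0 \<longrightarrow> norm (slash_half f \<sigma> \<tau>) \<le> C * Im \<tau> ^ k))"

definition M_half :: "nat \<Rightarrow> (int \<Rightarrow> complex) \<Rightarrow> (complex \<Rightarrow> complex) set" where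
  "M_half N chi = {f. f holomorphic_on \<H> \<and> modular_half N chi f \<and> poly_growth_at_cusps f}"

text \<open>Real-analytic in the two real variables \<open>Re z\<close> and \<open>Im z\<close>: locally the sum of a
  convergent double power series.\<close>

definition real_analytic_on :: "(complex \<Rightarrow> complex) \<Rightarrow> complex set \<Rightarrow> bool" where
  "real_analytic_on f S \<longleftrightarrow>
     (\<forall>z\<in>S. \<exists>r>0. \<exists>p :: nat \<times> nat \<Rightarrow> complex. \<forall>x y :: real. \<bar>x\<bar> < r \<longrightarrow> \<bar>y\<bar> < r \<longrightarrow>
        ((\<lambda>(j, k). p (j, k) * of_real x ^ j * of_real y ^ k) has_sum f (z + Complex x y)) UNIV)"

definition du :: "(complex \<Rightarrow> complex) \<Rightarrow> complex \<Rightarrow> complex" where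
  "du f \<tau> = vector_derivative (\<lambda>x :: real. f (\<tau> + of_real x)) (at 0)"

definition dv :: "(complex \<Rightarrow> complex) \<Rightarrow> complex \<Rightarrow> complex" where
  "dv f \<tau> = vector_derivative (\<lambda>y :: real. f (\<tau> + \<i> * of_real y)) (at 0)"

definition Delta_half :: "(complex \<Rightarrow> complex) \<Rightarrow> complex \<Rightarrow> complex" where
  "Delta_half f \<tau> =
     - (of_real (Im \<tau>))\<^sup>2 * (du (du f) \<tau> + dv (dv f) \<tau>)
     + \<i> / 2 * of_real (Im \<tau>) * (du f \<tau> + \<i> * dv f \<tau>)"

definition Vmg_half :: "nat \<Rightarrow> (int \<Rightarrow> complex) \<Rightarrow> (complex \<Rightarrow> complex) set" where
  "Vmg_half N chi = {F. real_analytic_on F \<H> \<and> modular_half N chi F \<and>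
     Delta_half F \<in> M_half N chi \<and> poly_growth_at_cusps F}"

definition fricke :: "nat \<Rightarrow> (complex \<Rightarrow> complex) \<Rightarrow> complex \<Rightarrow> complex" where
  "fricke N F \<tau> =
     of_real (real N powr (1/4)) * (of_nat N * \<tau>) powr (-1/2) * F (- 1 / (of_nat N * \<tau>))"

definition alpha :: "real \<Rightarrow> real" where
  "alpha y = sqrt y / (4 * pi) * (LBINT t:{0<..}. t powr (-1/2) * exp (- pi * y * t) * ln (1 + t))"

definition beta :: "real \<Rightarrow> real" where
  "beta y = 1 / sqrt pi * (LBINT t:{pi * y<..}. t powr (-1/2) * exp (- t))"

definition inc_Gamma :: "real \<Rightarrow> real \<Rightarrow> real" where
  "inc_Gamma \<nu> a = (LBINT y:{a<..}. exp (- y) * y powr (\<nu> - 1))"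

text \<open>The coefficients \<open>d\<^sub>F(0), d\<^sub>F(1), d\<^sub>F(2)\<close>, \<open>c\<^sub>F(n)\<close>, \<open>b\<^sub>F(n)\<close>, \<open>a\<^sub>F(n)\<close>.  Only \<open>d_coeff\<close> at
  \<open>0, 1, 2\<close>, \<open>c_coeff\<close> and \<open>a_coeff\<close> at \<open>n > 0\<close>, and \<open>b_coeff\<close> at \<open>n < 0\<close> are ever used.\<close>

record fourier_coeffs =
  d_coeff :: "nat \<Rightarrow> complex"
  c_coeff :: "int \<Rightarrow> complex"
  b_coeff :: "int \<Rightarrow> complex"
  a_coeff :: "int \<Rightarrow> complex"

definition poly_growth_coeffs :: "int set \<Rightarrow> (int \<Rightarrow> complex) \<Rightarrow> bool" where
  "poly_growth_coeffs S c \<longleftrightarrow>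
     (\<exists>(C :: real) (k :: nat). \<forall>n\<in>S. norm (c n) \<le> C * \<bar>of_int n\<bar> ^ k)"

text \<open>The growth conditions make the three series absolutely convergent.\<close>

definition has_fourier_expansion :: "(complex \<Rightarrow> complex) \<Rightarrow> fourier_coeffs \<Rightarrow> bool" where
  "has_fourier_expansion F A \<longleftrightarrow>
     poly_growth_coeffs {0<..} (c_coeff A) \<and>
     poly_growth_coeffs {..<0} (b_coeff A) \<and>
     poly_growth_coeffs {0<..} (a_coeff A) \<and>
     (\<forall>\<tau>\<in>\<H>. F \<tau> =
        d_coeff A 0 + d_coeff A 1 * of_real (ln (Im \<tau>)) + d_coeff A 2 * of_real (sqrt (Im \<tau>))
        + (\<Sum>\<^sub>\<infinity>n\<in>{0<..}. c_coeff A n * qq \<tau> powi n)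
        + (\<Sum>\<^sub>\<infinity>n\<in>{..<0}. b_coeff A n * of_real (beta (- 4 * of_int n * Im \<tau>)) * qq \<tau> powi n)
        + (\<Sum>\<^sub>\<infinity>n\<in>{0<..}. a_coeff A n * of_real (alpha (4 * of_int n * Im \<tau>)) * qq \<tau> powi n))"

definition W_integrand :: "complex \<Rightarrow> real \<Rightarrow> complex" where
  "W_integrand s x = of_real (inc_Gamma (1/2) (2 * x) * exp x) * of_real x powr (s - 1)"

definition W_half :: "complex \<Rightarrow> complex" where
  "W_half s = (LBINT x:{0<..}. W_integrand s x)"

definition Z_integrand :: "complex \<Rightarrow> real \<Rightarrow> complex" where
  "Z_integrand s x = of_real (alpha (2 * x / pi) * exp (- x)) * of_real x powr (s - 1)"

definition Z_int :: "complex \<Rightarrow> complex" where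
  "Z_int s = (LBINT x:{0<..}. Z_integrand s x)"

definition L_plus_term :: "fourier_coeffs \<Rightarrow> complex \<Rightarrow> nat \<Rightarrow> complex" where
  "L_plus_term A s n = c_coeff A (int n) * of_nat n powr (- s)"

definition L_minus_term :: "fourier_coeffs \<Rightarrow> complex \<Rightarrow> nat \<Rightarrow> complex" where
  "L_minus_term A s n = b_coeff A (- int n) * of_nat n powr (- s)"

definition L_star_term :: "fourier_coeffs \<Rightarrow> complex \<Rightarrow> nat \<Rightarrow> complex" where
  "L_star_term A s n = a_coeff A (int n) * of_nat n powr (- s)"

definition L_plus :: "fourier_coeffs \<Rightarrow> complex \<Rightarrow> complex" where
  "L_plus A s = (\<Sum>\<^sub>\<infinity>n\<in>{1..}. L_plus_term A s n)"

definition L_minus :: "fourier_coeffs \<Rightarrow> complex \<Rightarrow> complex" where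
  "L_minus A s = (\<Sum>\<^sub>\<infinity>n\<in>{1..}. L_minus_term A s n)"

definition L_star :: "fourier_coeffs \<Rightarrow> complex \<Rightarrow> complex" where
  "L_star A s = (\<Sum>\<^sub>\<infinity>n\<in>{1..}. L_star_term A s n)"

definition Lambda :: "nat \<Rightarrow> fourier_coeffs \<Rightarrow> complex \<Rightarrow> complex" where
  "Lambda N A s = of_real (sqrt (real N) / (2 * pi)) powr s *
     (Gamma s * L_plus A s + 1 / of_real (sqrt pi) * W_half s * L_minus A s + Z_int s * L_star A s)"

definition Lambda_defined :: "fourier_coeffs \<Rightarrow> complex \<Rightarrow> bool" where
  "Lambda_defined A s \<longleftrightarrow>
     (\<lambda>n. norm (L_plus_term A s n)) summable_on {1..} \<and>
     (\<lambda>n. norm (L_minus_term A s n)) summable_on {1..} \<and>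
     (\<lambda>n. norm (L_star_term A s n)) summable_on {1..} \<and>
     set_integrable lborel {0<..} (W_integrand s) \<and>
     set_integrable lborel {0<..} (Z_integrand s)"

text \<open>Being nicely meromorphic fixes the values of \<open>f\<close> at removable singularities (the limit)
  and at poles (zero), so that the continuation is a uniquely determined function.\<close>

definition Lambda_continuation :: "nat \<Rightarrow> fourier_coeffs \<Rightarrow> (complex \<Rightarrow> complex) \<Rightarrow> bool" where
  "Lambda_continuation N A f \<longleftrightarrow> f nicely_meromorphic_on UNIV \<and>
     (\<exists>\<sigma>. \<forall>s. Re s > \<sigma> \<longrightarrow> Lambda_defined A s \<and> f s = Lambda N A s)"

definition simple_pole :: "(complex \<Rightarrow> complex) \<Rightarrow> complex \<Rightarrow> bool" where
  "simple_pole f z \<longleftrightarrow> is_pole f z \<and> zorder f z = - 1"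

definition double_pole :: "(complex \<Rightarrow> complex) \<Rightarrow> complex \<Rightarrow> bool" where
  "double_pole f z \<longleftrightarrow> is_pole f z \<and> zorder f z = - 2"

text \<open>At most a simple pole, with residue \<open>r\<close>; no pole if \<open>r = 0\<close>.\<close>

definition simple_pole_res :: "(complex \<Rightarrow> complex) \<Rightarrow> complex \<Rightarrow> complex \<Rightarrow> bool" where
  "simple_pole_res f z r \<longleftrightarrow>
     residue f z = r \<and> (if r = 0 then \<not> is_pole f z else simple_pole f z)"

text \<open>A double pole if \<open>dbl\<close> holds, and otherwise at most a simple pole; residue \<open>r\<close> in either case.\<close>

definition double_pole_res :: "bool \<Rightarrow> (complex \<Rightarrow> complex) \<Rightarrow> complex \<Rightarrow> complex \<Rightarrow> bool" where
  "double_pole_res dbl f z r \<longleftrightarrow>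
     (if dbl then double_pole f z \<and> residue f z = r else simple_pole_res f z r)"

end

theory Submission
  imports Defs
begin

text \<open>On the imaginary axis, \<open>F (i t / \<surd>N)\<close> minus its constant terms has Mellin transform
  \<open>\<Lambda>\<^sub>N(F, s)\<close>: the three kinds of Fourier terms produce \<open>\<Gamma>(s)\<close>, \<open>W(s)\<close> and \<open>Z(s)\<close>. As in Hecke's
  argument, the integral is cut at \<open>t = 1\<close> and \<open>t \<mapsto> 1/t\<close> is applied to the lower half, where the Fricke
  involution turns \<open>F (i / (t \<surd>N))\<close> into \<open>i\<^sup>1\<^sup>/\<^sup>2 t\<^sup>1\<^sup>/\<^sup>2 G (i t / \<surd>N)\<close>. What remains are two entire integrals
  over \<open>t > 1\<close> and the integrals of the constant terms, which account for all the poles.\<close>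

section \<open>Kernels and Mellin transforms\<close>

text \<open>The coefficient bounds give convergence only far to the right, so the cut formula is
  proved for large Re s and its right-hand side then defines the continuation. Over t > 1 the
  integral of t^(-z) is 1/(z - 1) and that of ln t * t^(-z) is 1/(z - 1)^2, so double poles come
  from the logarithmic terms alone. The exponents -s-1 and -s-3/2 for the constant terms of F, and
  -s-1/2 and -s for those of G (which carry an extra sqrt t), place the poles at 0, -1/2, 1/2 and 1;
  ln (sqrt N) and N^(-1/4) enter because v = t / sqrt N. Read at 1/t, the Fricke relation expresses
  G through F with the inverse factor i^(-1/2). The formula for G is thus the one for F with the two
  coefficient records exchanged, and the functional equation becomes an identity between explicit
  expressions. For it to hold at every s, poles included, both sides are normalised by
  \<open>remove_sings\<close>, which takes the limit where one exists and 0 elsewhere.\<close>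

lemma set_integrable_lborel_if_absolutely_integrable:
  fixes f :: "real \<Rightarrow> 'a::euclidean_space"
  assumes "f absolutely_integrable_on S" and "(\<lambda>x. indicator S x *\<^sub>R f x) \<in> borel_measurable borel"
  shows "set_integrable lborel S f"
  using assms by (simp add: set_integrable_def integrable_completion)

lemma set_integrable_lborel_if_nonneg:
  fixes f :: "real \<Rightarrow> real"
  assumes "(f has_integral I) S" and "\<And>x. x \<in> S \<Longrightarrow> 0 \<le> f x"
    and "(\<lambda>x. indicator S x *\<^sub>R f x) \<in> borel_measurable borel"
  shows "set_integrable lborel S f" and "(LBINT x:S. f x) = I"
proof -
  have "f absolutely_integrable_on S"
    using assms by (intro nonnegative_absolutely_integrable_1) (auto simp: integrable_on_def)
  then show *: "set_integrable lborel S f"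
    using assms(3) by (rule set_integrable_lborel_if_absolutely_integrable)
  show "(LBINT x:S. f x) = I"
    using set_borel_integral_eq_integral(2)[OF *] assms(1) by (simp add: integral_unique)
qed

lemma set_lborel_exp_Ioi:
  fixes a c :: real
  assumes "c > 0"
  shows "set_integrable lborel {a<..} (\<lambda>t. exp (- c * t))"
    and "(LBINT t:{a<..}. exp (- c * t)) = exp (- c * a) / c"
proof -
  have "((\<lambda>t. exp (- c * t)) has_integral exp (- c * a) / c) {a..}"
    using has_integral_exp_minus_to_infinity[OF assms] by simp
  then have "((\<lambda>t. exp (- c * t)) has_integral exp (- c * a) / c) {a<..}"
    by (subst has_integral_spike_set_eq[of _ "{a..}"]) (auto intro: negligible_subset[of "{a}"])
  then show "set_integrable lborel {a<..} (\<lambda>t. exp (- c * t))"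
    "(LBINT t:{a<..}. exp (- c * t)) = exp (- c * a) / c"
    by (rule set_integrable_lborel_if_nonneg; simp)+
qed

text \<open>A single bound that fits all three kernels: exponential decay at infinity and growth of
  at most 1/x at 0. The factor 1/x accommodates the crude estimate of \<open>alpha\<close> by 1/y;
  its price is that the Mellin transform is only controlled for Re s > 1.\<close>

definition decaying :: "(real \<Rightarrow> real) \<Rightarrow> bool" where
  "decaying K \<longleftrightarrow> K \<in> borel_measurable borel \<and> (\<exists>C. \<forall>x>0. \<bar>K x\<bar> \<le> C * (1 + 1 / x) * exp (- x))"

lemma decaying_exp: "decaying (\<lambda>x. exp (- x))"
  unfolding decaying_def by (auto intro!: exI[of _ 1] simp: field_simps)

lemma borel_measurable_beta [measurable]: "beta \<in> borel_measurable borel"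
proof -
  \<comment> \<open>The parameter sits in the domain of integration; moved into the integrand, it
    leaves a jointly measurable function of y and t.\<close>
  have "beta = (\<lambda>y. 1 / sqrt pi * (LBINT t. (if pi * y < t then t powr (-1/2) * exp (- t) else 0)))"
    by (rule ext) (auto simp: beta_def set_lebesgue_integral_def intro!: Bochner_Integration.integral_cong)
  also have "\<dots> \<in> borel_measurable borel"
    by measurable
  finally show ?thesis .
qed

lemma borel_measurable_alpha [measurable]: "alpha \<in> borel_measurable borel"
  unfolding alpha_def[abs_def] set_lebesgue_integral_def by measurable

text \<open>For t > 2x the factor t^(-1/2) is at most (2x)^(-1/2), so the integral is at most
  (2x)^(-1/2) * exp (-2x). Half of this decay pays for \<open>exp x\<close>, which stems from q^n
  with n negative.\<close>

lemma decaying_beta: "decaying (\<lambda>x. beta (2 * x / pi) * exp x)"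
  unfolding decaying_def
proof (intro conjI exI allI impI)
  fix x :: real assume x: "x > 0"
  let ?f = "\<lambda>t. indicator {2 * x<..} t *\<^sub>R (t powr (-1/2) * exp (- t)) :: real"
  let ?g = "\<lambda>t. (2 * x) powr (-1/2) * (indicator {2 * x<..} t *\<^sub>R exp (- 1 * t)) :: real"
  have g: "integrable lborel (\<lambda>t. indicator {2 * x<..} t *\<^sub>R exp (- 1 * t) :: real)"
    using set_lborel_exp_Ioi(1)[of 1 "2 * x"] by (simp add: set_integrable_def)
  have le: "0 \<le> ?f t" "?f t \<le> ?g t" for t
    using x by (auto simp: indicator_def intro!: mult_right_mono powr_mono2')
  have eq: "beta (2 * x / pi) = 1 / sqrt pi * integral\<^sup>L lborel ?f"
    by (simp add: beta_def set_lebesgue_integral_def)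
  have "0 \<le> integral\<^sup>L lborel ?f"
    using le by (intro Bochner_Integration.integral_nonneg) auto
  moreover have "integral\<^sup>L lborel ?f \<le> integral\<^sup>L lborel ?g"
    by (rule integral_mono') (use g le order_trans[OF le] in auto)
  moreover have "integral\<^sup>L lborel ?g = (2 * x) powr (-1/2) * exp (- (2 * x))"
    using set_lborel_exp_Ioi(2)[of 1 "2 * x"] by (simp add: set_lebesgue_integral_def)
  \<comment> \<open>The left side is at most 1 if 2x is at least 1, and at most 1/(2x)
    otherwise.\<close>
  moreover have "(2 * x) powr (-1/2) \<le> 1 + 1 / x"
  proof (cases "2 * x \<ge> 1")
    case True
    then have "(2 * x) powr (-1/2) \<le> (2 * x) powr 0"
      by (intro powr_mono) auto
    also have "\<dots> \<le> 1 + 1 / x" using x by simp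
    finally show ?thesis .
  next
    case False
    then have "(2 * x) powr (-1/2) \<le> (2 * x) powr (-1)"
      using x by (intro powr_mono') auto
    also have "\<dots> \<le> 1 + 1 / x" using x by (simp add: powr_minus field_simps)
    finally show ?thesis .
  qed
  ultimately have "0 \<le> integral\<^sup>L lborel ?f" "integral\<^sup>L lborel ?f \<le> (1 + 1 / x) * exp (- (2 * x))"
    by (auto elim!: order_trans intro!: mult_right_mono)
  then have "\<bar>integral\<^sup>L lborel ?f * exp x\<bar> \<le> (1 + 1 / x) * exp (- (2 * x)) * exp x"
    by (simp add: abs_mult)
  also have "\<dots> = (1 + 1 / x) * exp (- x)"
    by (simp add: mult.assoc flip: exp_add)
  finally have "1 / sqrt pi * \<bar>integral\<^sup>L lborel ?f * exp x\<bar> \<le> 1 / sqrt pi * ((1 + 1 / x) * exp (- x))"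
    by (intro mult_left_mono) auto
  then show "\<bar>beta (2 * x / pi) * exp x\<bar> \<le> 1 / sqrt pi * (1 + 1 / x) * exp (- x)"
    by (simp add: eq abs_mult mult.assoc)
qed measurable

text \<open>Since ln (1 + t) \<le> t, the integrand is at most sqrt t * exp (-2ct) with c = pi * y /
  2. Half of the exponent absorbs sqrt t, because sqrt (ct) \<le> 1 + ct \<le> exp (ct); the other
  half integrates to 1/c. The total sqrt y * c^(-3/2) is a multiple of 1/y, with a factor below
  1.\<close>

lemma alpha_bounds:
  assumes y: "y > 0"
  shows "0 \<le> alpha y" and "alpha y \<le> 1 / y"
proof -
  define c where "c = pi * y / 2"
  have c: "c > 0" using y by (simp add: c_def)
  let ?f = "\<lambda>t. indicator {0<..} t *\<^sub>R (t powr (-1/2) * exp (- pi * y * t) * ln (1 + t)) :: real"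
  let ?g = "\<lambda>t. 1 / sqrt c * (indicator {0<..} t *\<^sub>R exp (- c * t)) :: real"
  have g: "integrable lborel (\<lambda>t. indicator {0<..} t *\<^sub>R exp (- c * t) :: real)"
    using set_lborel_exp_Ioi(1)[OF c, of 0] by (simp add: set_integrable_def)
  have nonneg: "0 \<le> ?f t" for t
    by (auto simp: indicator_def intro!: mult_nonneg_nonneg)
  have le: "?f t \<le> ?g t" for t
  proof (cases "t > 0")
    case True
    have "sqrt (c * t) \<le> 1 + c * t"
      using sqrt_le_D True c by (intro real_le_lsqrt) (auto simp: power2_eq_square algebra_simps)
    also have "\<dots> \<le> exp (c * t)"
      by (rule exp_ge_add_one_self)
    finally have "sqrt c * sqrt t \<le> exp (c * t)"
      by (simp add: real_sqrt_mult)
    then have *: "sqrt t \<le> exp (c * t) / sqrt c"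
      using c by (simp add: field_simps)
    have "t powr (-1/2) * exp (- pi * y * t) * ln (1 + t) \<le> t powr (-1/2) * exp (- pi * y * t) * t"
      using True by (intro mult_left_mono ln_add_one_self_le_self) auto
    also have "\<dots> = sqrt t * exp (- c * t) * exp (- c * t)"
      using True by (simp add: powr_minus powr_half_sqrt c_def field_simps flip: exp_add)
    also have "\<dots> \<le> exp (c * t) / sqrt c * exp (- c * t) * exp (- c * t)"
      using * by (intro mult_right_mono) auto
    also have "\<dots> = 1 / sqrt c * exp (- c * t)"
      by (simp add: exp_minus)
    finally show ?thesis using True by simp
  qed auto
  have "0 \<le> integral\<^sup>L lborel ?f"
    using nonneg by (intro Bochner_Integration.integral_nonneg) auto
  then show "0 \<le> alpha y"
    using y by (simp add: alpha_def set_lebesgue_integral_def)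
  have "integral\<^sup>L lborel ?f \<le> integral\<^sup>L lborel ?g"
    by (rule integral_mono') (use g le order_trans[OF nonneg le] in auto)
  also have "\<dots> = 1 / sqrt c * (1 / c)"
    using set_lborel_exp_Ioi(2)[OF c, of 0] by (simp add: set_lebesgue_integral_def)
  finally have "alpha y \<le> sqrt y / (4 * pi) * (1 / sqrt c * (1 / c))"
    unfolding alpha_def set_lebesgue_integral_def using y by (intro mult_left_mono) auto
  also have "\<dots> = 1 / (4 * pi * sqrt (pi / 2) * (pi / 2)) * (1 / y)"
    using y by (simp add: c_def real_sqrt_mult real_sqrt_divide field_simps)
  also have "\<dots> \<le> 1 * (1 / y)"
  proof (intro mult_right_mono)
    have "1 \<le> pi / 2" using pi_ge_two by simp
    then have "1 * 1 * 1 \<le> (4 * pi) * sqrt (pi / 2) * (pi / 2)"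
      by (intro mult_mono) auto
    then show "1 / (4 * pi * sqrt (pi / 2) * (pi / 2)) \<le> 1" by simp
  qed (use y in auto)
  finally show "alpha y \<le> 1 / y" by simp
qed

lemma decaying_alpha: "decaying (\<lambda>x. alpha (2 * x / pi) * exp (- x))"
  unfolding decaying_def
proof (intro conjI exI allI impI)
  fix x :: real assume x: "x > 0"
  have "\<bar>alpha (2 * x / pi) * exp (- x)\<bar> \<le> 1 / (2 * x / pi) * exp (- x)"
    unfolding abs_mult using alpha_bounds[of "2 * x / pi"] x by (intro mult_mono) auto
  also have "\<dots> \<le> pi * (1 + 1 / x) * exp (- x)"
    using x by (intro mult_right_mono) (auto simp: field_simps)
  finally show "\<bar>alpha (2 * x / pi) * exp (- x)\<bar> \<le> pi * (1 + 1 / x) * exp (- x)" .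
qed measurable

text \<open>The two summands of the decay bound turn into the Gamma integrands at Re s and at Re s -
  1; the second one demands Re s > 1.\<close>

lemma decaying_mellin_integrable:
  assumes K: "decaying K" and s: "Re s > 1"
  shows "set_integrable lborel {0<..} (\<lambda>x. of_real (K x) * of_real x powr (s - 1) :: complex)"
proof -
  have [measurable]: "K \<in> borel_measurable borel"
    using K by (simp add: decaying_def)
  obtain C where C: "\<And>x. x > 0 \<Longrightarrow> \<bar>K x\<bar> \<le> C * (1 + 1 / x) * exp (- x)"
    using K by (auto simp: decaying_def)
  have gam: "set_integrable lborel {0<..} (\<lambda>t. t powr (a - 1) / exp t :: real)" if "a > 0" for a :: real
  proof -
    have "((\<lambda>t. t powr (a - 1) / exp t) has_integral Gamma a) {0<..}"
      using Gamma_integral_real[OF that]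
      by (subst has_integral_spike_set_eq[of _ "{0..}"]) (auto intro: negligible_subset[of "{0}"])
    then show ?thesis
      by (rule set_integrable_lborel_if_nonneg) auto
  qed
  have "set_integrable lborel {0<..} (\<lambda>t. C * (t powr (Re s - 1) / exp t + t powr (Re s - 1 - 1) / exp t))"
    using s by (intro set_integrable_mult_right set_integral_add(1) gam) auto
  then show ?thesis
    unfolding set_integrable_def
  proof (rule Bochner_Integration.integrable_bound)
    show "AE x in lborel. norm (indicator {0<..} x *\<^sub>R (of_real (K x) * of_real x powr (s - 1) :: complex))
      \<le> norm (indicator {0<..} x *\<^sub>R (C * (x powr (Re s - 1) / exp x + x powr (Re s - 1 - 1) / exp x)))"
    proof (intro AE_I2)
      fix x :: real
      show "norm (indicator {0<..} x *\<^sub>R (of_real (K x) * of_real x powr (s - 1) :: complex))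
      \<le> norm (indicator {0<..} x *\<^sub>R (C * (x powr (Re s - 1) / exp x + x powr (Re s - 1 - 1) / exp x)))"
      proof (cases "x > 0")
        case True
        then have "norm (of_real (K x) * of_real x powr (s - 1) :: complex) = \<bar>K x\<bar> * x powr (Re s - 1)"
          by (simp add: norm_mult norm_powr_real_powr)
        also have "\<dots> \<le> C * (1 + 1 / x) * exp (- x) * x powr (Re s - 1)"
          using C[OF True] by (intro mult_right_mono) auto
        also have "\<dots> = C * (x powr (Re s - 1) / exp x + x powr (Re s - 1 - 1) / exp x)"
          using True by (simp add: powr_diff exp_minus power2_eq_square field_simps)
        finally show ?thesis using True by auto
      qed auto
    qed
  qed measurable
qed

text \<open>One power of x cancels the possible singularity at 0, and x^j * exp (-x) \<le> j! takes
  care of the rest.\<close>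

lemma decaying_power_bound:
  assumes "decaying K"
  obtains M where "\<And>x. x > 0 \<Longrightarrow> \<bar>K x\<bar> * x ^ Suc m \<le> M"
proof -
  obtain C where C: "\<And>x. x > 0 \<Longrightarrow> \<bar>K x\<bar> \<le> C * (1 + 1 / x) * exp (- x)"
    using assms by (auto simp: decaying_def)
  \<comment> \<open>The bound evaluated at x = 1 forces C to be nonnegative.\<close>
  have "0 \<le> C * (1 + 1 / 1) * exp (- 1)"
    using C[of 1] by (rule order_trans[OF abs_ge_zero]) simp
  then have "C \<ge> 0"
    by (simp add: zero_le_mult_iff)
  have fact: "x ^ j * exp (- x) \<le> fact j" if "x > 0" for x :: real and j
  proof -
    have "(\<Sum>n\<in>{j}. x ^ n /\<^sub>R fact n) \<le> (\<Sum>n. x ^ n /\<^sub>R fact n)"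
      using that by (intro sum_le_suminf summable_exp_generic) auto
    then have "x ^ j / fact j \<le> exp x"
      by (simp add: exp_def divide_inverse_commute)
    then show ?thesis
      by (simp add: exp_minus field_simps)
  qed
  show ?thesis
  proof (rule that)
    fix x :: real assume x: "x > 0"
    have "\<bar>K x\<bar> * x ^ Suc m \<le> C * (1 + 1 / x) * exp (- x) * x ^ Suc m"
      using x C[OF x] by (intro mult_right_mono) auto
    also have "\<dots> = C * (x ^ Suc m * exp (- x) + x ^ m * exp (- x))"
      using x by (simp add: field_simps)
    also have "\<dots> \<le> C * (fact (Suc m) + fact m)"
      using \<open>C \<ge> 0\<close> x by (intro mult_left_mono add_mono fact) auto
    finally show "\<bar>K x\<bar> * x ^ Suc m \<le> C * (fact (Suc m) + fact m)" .
  qed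
qed

section \<open>Termwise Mellin transforms of kernel series\<close>

lemma set_integral_Ioi_scale:
  fixes f :: "real \<Rightarrow> 'a::{banach, second_countable_topology}"
  assumes "c > 0" and "set_integrable lborel {0<..} f"
  shows "set_integrable lborel {0<..} (\<lambda>t. f (c * t))"
    and "(LBINT t:{0<..}. f (c * t)) = (LBINT x:{0<..}. f x) /\<^sub>R c"
proof -
  have *: "indicator {0<..} (c * t) = (indicator {0<..} t :: real)" for t
    using assms(1) by (simp add: indicator_def zero_less_mult_iff)
  show "set_integrable lborel {0<..} (\<lambda>t. f (c * t))"
    using lborel_integrable_real_affine[of "\<lambda>x. indicator {0<..} x *\<^sub>R f x" c 0] assms
    by (simp add: set_integrable_def *)
  show "(LBINT t:{0<..}. f (c * t)) = (LBINT x:{0<..}. f x) /\<^sub>R c"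
    using lborel_integral_real_affine[of c "\<lambda>x. indicator {0<..} x *\<^sub>R f x" 0] assms
    by (simp add: set_lebesgue_integral_def *)
qed

text \<open>\<open>u n\<close> is the coefficient at frequency n + 1, so that sums over positive or
  negative integers become ordinary series over the naturals.\<close>

definition kernel_sum :: "(real \<Rightarrow> real) \<Rightarrow> (nat \<Rightarrow> complex) \<Rightarrow> real \<Rightarrow> complex" where
  "kernel_sum K u t = (\<Sum>n. u n * of_real (K (real (Suc n) * t)))"

text \<open>Decay of order k + 2 against coefficients of order k leaves a multiple of the series of
  1/n^2.\<close>

lemma summable_kernel_sum:
  assumes K: "decaying K" and u: "\<And>n. norm (u n) \<le> C * real (Suc n) ^ k" and t: "t > 0"
  shows "summable (\<lambda>n. norm (u n * of_real (K (real (Suc n) * t)) :: complex))"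
proof -
  obtain M where M: "\<And>x. x > 0 \<Longrightarrow> \<bar>K x\<bar> * x ^ Suc (Suc k) \<le> M"
    using decaying_power_bound[OF K] by metis
  have "0 \<le> C"
    using order_trans[OF norm_ge_zero u[of 0]] by simp
  show ?thesis
  proof (rule summable_comparison_test')
    have "summable (\<lambda>n. inverse (real (Suc n) ^ 2))"
      by (subst summable_Suc_iff) (rule inverse_power_summable, simp)
    then show "summable (\<lambda>n. C * M / t ^ Suc (Suc k) * inverse (real (Suc n) ^ 2))"
      by (rule summable_mult)
    fix n :: nat
    let ?x = "real (Suc n) * t"
    have x: "?x > 0" using t by simp
    have "norm (u n * of_real (K ?x)) = norm (u n) * \<bar>K ?x\<bar>"
      by (simp add: norm_mult)
    also have "\<dots> \<le> (C * real (Suc n) ^ k) * (M / ?x ^ Suc (Suc k))"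
      using M[OF x] x \<open>0 \<le> C\<close> by (intro mult_mono u) (auto simp: pos_le_divide_eq)
    also have "\<dots> = C * M / t ^ Suc (Suc k) * inverse (real (Suc n) ^ 2)"
      by (simp add: power_mult_distrib field_simps power2_eq_square del: of_nat_Suc)
    finally show "norm (norm (u n * of_real (K ?x))) \<le> C * M / t ^ Suc (Suc k) * inverse (real (Suc n) ^ 2)"
      by simp
  qed
qed

text \<open>The substitution x = (n + 1) * r * t takes every term to the same Mellin integral and
  pulls out ((n + 1) * r)^(-s). The same substitution applied to norms shows that the L1 norms of
  the terms are a constant times those of an absolutely convergent Dirichlet series, which justifies
  summing under the integral. The bound on Re s yields both that convergence and Re s > 1.\<close>

lemma mellin_kernel_sum:
  assumes K: "decaying K" and u: "\<And>n. norm (u n) \<le> C * real (Suc n) ^ k"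
    and r: "r > 0" and s: "Re s > real k + 1"
  shows "summable (\<lambda>n. norm (u n * of_nat (Suc n) powr (- s)))"
    and "set_integrable lborel {0<..} (\<lambda>t. kernel_sum K u (r * t) * of_real t powr (s - 1))"
    and "(LBINT t:{0<..}. kernel_sum K u (r * t) * of_real t powr (s - 1)) =
           of_real r powr (- s) * (\<Sum>n. u n * of_nat (Suc n) powr (- s)) *
           (LBINT x:{0<..}. of_real (K x) * of_real x powr (s - 1))"
proof -
  let ?h = "\<lambda>x. of_real (K x) * of_real x powr (s - 1) :: complex"
  define c where "c = (\<lambda>n. real (Suc n) * r)"
  have c: "c n > 0" for n using r by (simp add: c_def)
  have "0 \<le> C"
    using order_trans[OF norm_ge_zero u[of 0]] by simp
  have "summable (\<lambda>n. real (Suc n) powr (real k - Re s))"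
    by (subst summable_Suc_iff) (use s in \<open>simp add: summable_real_powr_iff\<close>)
  then have sumC: "summable (\<lambda>n. C * real (Suc n) powr (real k - Re s))"
    by (rule summable_mult)
  show sumu: "summable (\<lambda>n. norm (u n * of_nat (Suc n) powr (- s)))"
  proof (rule summable_comparison_test'[OF sumC])
    fix n :: nat
    have "norm (of_nat (Suc n) powr (- s) :: complex) = norm (of_real (real (Suc n)) powr (- s) :: complex)"
      by simp
    also have "\<dots> = real (Suc n) powr (- Re s)"
      by (subst norm_powr_real_powr) (auto simp del: of_nat_Suc)
    finally have "norm (u n * of_nat (Suc n) powr (- s)) = norm (u n) * real (Suc n) powr (- Re s)"
      by (simp add: norm_mult del: of_nat_Suc)
    also have "\<dots> \<le> C * real (Suc n) ^ k * real (Suc n) powr (- Re s)"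
      by (intro mult_right_mono u) auto
    also have "\<dots> = C * real (Suc n) powr (real k - Re s)"
      by (simp add: powr_diff powr_minus powr_realpow field_simps del: of_nat_Suc)
    finally show "norm (norm (u n * of_nat (Suc n) powr (- s))) \<le> C * real (Suc n) powr (real k - Re s)"
      by simp
  qed
  have h: "set_integrable lborel {0<..} ?h"
    using s by (intro decaying_mellin_integrable K) auto
  let ?f = "\<lambda>n t. indicator {0<..} t *\<^sub>R (u n * of_real (K (c n * t)) * of_real t powr (s - 1))"
  \<comment> \<open>Each term becomes a rescaled copy of the fixed function \<open>?h\<close>; the
    powers with exponent 1 - s undo the power of \<open>c n\<close> contained in
    \<open>?h (c n * t)\<close>.\<close>
  have f: "?f n t = of_real r powr (1 - s) * (u n * of_nat (Suc n) powr (1 - s)) *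
      (indicator {0<..} t *\<^sub>R ?h (c n * t))" for n t
  proof (cases "t > 0")
    case True
    have "of_real (c n * t) powr (s - 1) =
        of_real r powr (s - 1) * of_nat (Suc n) powr (s - 1) * (of_real t powr (s - 1) :: complex)"
      unfolding c_def of_real_mult using True r
      by (subst powr_times_real; simp add: powr_times_real mult_ac del: of_nat_Suc)+
    moreover have "of_real r powr (1 - s) * of_real r powr (s - 1) = (1 :: complex)"
      using r by (simp flip: powr_add)
    moreover have "of_nat (Suc n) powr (1 - s) * of_nat (Suc n) powr (s - 1) = (1 :: complex)"
      by (simp del: of_nat_Suc flip: powr_add)
    ultimately have "of_real r powr (1 - s) * of_nat (Suc n) powr (1 - s) * of_real (c n * t) powr (s - 1)
        = (of_real t powr (s - 1) :: complex)"
      by (simp add: mult_ac)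
    then show ?thesis using True by (simp add: algebra_simps)
  qed auto
  have int: "integrable lborel (\<lambda>t. indicator {0<..} t *\<^sub>R ?h (c n * t))" for n
    using set_integral_Ioi_scale(1)[OF c h] by (simp add: set_integrable_def)
  have intf: "integrable lborel (?f n)" for n
    unfolding f by (intro integrable_mult_right int)
  \<comment> \<open>Division by the Jacobian \<open>c n\<close> moves the exponent from 1 - s to
    -s.\<close>
  have factor: "of_real r powr (1 - s) * (u n * of_nat (Suc n) powr (1 - s)) / of_real (c n)
      = of_real r powr (- s) * (u n * of_nat (Suc n) powr (- s))" for n
    using r by (simp add: c_def powr_diff powr_minus field_simps del: of_nat_Suc)
  have If: "integral\<^sup>L lborel (?f n) =
      of_real r powr (- s) * (u n * of_nat (Suc n) powr (- s)) * (LBINT x:{0<..}. ?h x)" for n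
  proof -
    have "integral\<^sup>L lborel (?f n) = of_real r powr (1 - s) * (u n * of_nat (Suc n) powr (1 - s)) *
        (LBINT t:{0<..}. ?h (c n * t))"
      unfolding f set_lebesgue_integral_def by (rule integral_mult_right_zero)
    also have "\<dots> = of_real r powr (1 - s) * (u n * of_nat (Suc n) powr (1 - s)) / of_real (c n) *
        (LBINT t:{0<..}. ?h t)"
      by (subst set_integral_Ioi_scale(2)[OF c h]) (simp add: scaleR_conv_of_real field_simps)
    finally show ?thesis by (simp only: factor)
  qed
  have Ifn: "(\<integral>t. norm (?f n t) \<partial>lborel) =
      norm (of_real r powr (- s) :: complex) * norm (u n * of_nat (Suc n) powr (- s)) *
      (LBINT x:{0<..}. norm (?h x))" for n
  proof -
    have hn: "set_integrable lborel {0<..} (\<lambda>x. norm (?h x))"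
      using h by (rule set_integrable_norm)
    have "(\<integral>t. norm (?f n t) \<partial>lborel) =
        norm (of_real r powr (1 - s) * (u n * of_nat (Suc n) powr (1 - s))) *
        (LBINT t:{0<..}. norm (?h (c n * t)))"
      unfolding f set_lebesgue_integral_def
      by (subst integral_mult_right_zero[symmetric]) (simp add: norm_mult mult_ac)
    also have "\<dots> = norm (of_real r powr (1 - s) * (u n * of_nat (Suc n) powr (1 - s)) / of_real (c n)) *
        (LBINT t:{0<..}. norm (?h t))"
      using c[of n] by (subst set_integral_Ioi_scale(2)[OF c hn]) (simp add: norm_divide field_simps)
    finally show ?thesis by (simp only: factor norm_mult)
  qed
  have ae: "AE t in lborel. summable (\<lambda>n. norm (?f n t))"
  proof (intro AE_I2)
    fix t :: real
    show "summable (\<lambda>n. norm (?f n t))"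
    proof (cases "t > 0")
      case True
      have "summable (\<lambda>n. norm (u n * of_real (K (real (Suc n) * (r * t)))) * norm (of_real t powr (s - 1) :: complex))"
        using True r by (intro summable_mult2 summable_kernel_sum[OF K u]) auto
      then show ?thesis using True by (simp add: c_def norm_mult mult.assoc)
    qed auto
  qed
  have suml: "summable (\<lambda>n. \<integral>t. norm (?f n t) \<partial>lborel)"
    unfolding Ifn by (intro summable_mult2 summable_mult sumu)
  have eq: "(\<Sum>n. ?f n t) = indicator {0<..} t *\<^sub>R (kernel_sum K u (r * t) * of_real t powr (s - 1))" for t
  proof (cases "t > 0")
    case True
    have "summable (\<lambda>n. u n * of_real (K (real (Suc n) * (r * t))))"
      using True r by (intro summable_norm_cancel[OF summable_kernel_sum[OF K u]]) auto
    from suminf_mult2[OF this, of "of_real t powr (s - 1)"] show ?thesis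
      using True by (simp add: kernel_sum_def c_def mult.assoc)
  qed auto
  show "set_integrable lborel {0<..} (\<lambda>t. kernel_sum K u (r * t) * of_real t powr (s - 1))"
    using integrable_suminf[OF intf ae suml] by (simp only: eq set_integrable_def)
  have "(LBINT t:{0<..}. kernel_sum K u (r * t) * of_real t powr (s - 1)) = (\<Sum>n. integral\<^sup>L lborel (?f n))"
    using integral_suminf[OF intf ae suml] by (simp only: eq set_lebesgue_integral_def)
  also have "\<dots> = of_real r powr (- s) * (\<Sum>n. u n * of_nat (Suc n) powr (- s)) * (LBINT x:{0<..}. ?h x)"
    using summable_norm_cancel[OF sumu]
    by (simp add: If suminf_mult suminf_mult2[symmetric] summable_mult del: of_nat_Suc)
  finally show "(LBINT t:{0<..}. kernel_sum K u (r * t) * of_real t powr (s - 1)) =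
           of_real r powr (- s) * (\<Sum>n. u n * of_nat (Suc n) powr (- s)) *
           (LBINT x:{0<..}. of_real (K x) * of_real x powr (s - 1))" .
qed

section \<open>Tail integrals as entire functions\<close>

lemma set_integrable_mellin_tail:
  fixes \<phi> :: "real \<Rightarrow> complex"
  assumes int: "set_integrable lborel {1<..} (\<lambda>t. \<phi> t * of_real t powr (s - 1))" and "Re z \<le> Re s"
  shows "set_integrable lborel {1<..} (\<lambda>t. \<phi> t * of_real t powr (z - 1))"
  unfolding set_integrable_def
proof (rule Bochner_Integration.integrable_bound)
  show "integrable lborel (\<lambda>t. indicator {1<..} t *\<^sub>R (\<phi> t * of_real t powr (s - 1)))"
    using int by (simp add: set_integrable_def)
  then have [measurable]: "(\<lambda>t. indicator {1<..} t *\<^sub>R (\<phi> t * of_real t powr (s - 1))) \<in> borel_measurable borel"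
    by (simp add: borel_measurable_integrable)
  \<comment> \<open>Measurability is known for the product at s only, not for \<phi>, so the
    integrand at z is obtained from it by a power of t. As t > 1, that power has norm at most
    1.\<close>
  have eq: "indicator {1<..} t *\<^sub>R (\<phi> t * of_real t powr (z - 1)) =
      indicator {1<..} t *\<^sub>R (\<phi> t * of_real t powr (s - 1)) * of_real t powr (z - s)" for t
    by (auto simp: indicator_def mult.assoc simp flip: powr_add)
  show "(\<lambda>t. indicator {1<..} t *\<^sub>R (\<phi> t * of_real t powr (z - 1))) \<in> borel_measurable lborel"
    unfolding eq by measurable
  show "AE t in lborel. norm (indicator {1<..} t *\<^sub>R (\<phi> t * of_real t powr (z - 1)))
      \<le> norm (indicator {1<..} t *\<^sub>R (\<phi> t * of_real t powr (s - 1)))"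
  proof (intro AE_I2)
    fix t :: real
    show "norm (indicator {1<..} t *\<^sub>R (\<phi> t * of_real t powr (z - 1)))
      \<le> norm (indicator {1<..} t *\<^sub>R (\<phi> t * of_real t powr (s - 1)))"
      using assms(2) by (auto simp: indicator_def norm_mult norm_powr_real_powr intro!: mult_left_mono powr_mono)
  qed
qed

text \<open>Expanding \<open>t powr s = exp (s * ln t)\<close> and integrating termwise yields an everywhere
  convergent power series in \<open>s\<close>.\<close>

lemma holomorphic_mellin_tail:
  fixes \<phi> :: "real \<Rightarrow> complex"
  assumes int: "\<And>s. set_integrable lborel {1<..} (\<lambda>t. \<phi> t * of_real t powr (s - 1))"
  shows "(\<lambda>s. LBINT t:{1<..}. \<phi> t * of_real t powr (s - 1)) analytic_on UNIV"
proof -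
  let ?E = "\<lambda>s. LBINT t:{1<..}. \<phi> t * of_real t powr (s - 1)"
  define g where "g = (\<lambda>t. indicator {1<..} t *\<^sub>R (\<phi> t * of_real t powr (0 - 1)))"
  have g: "integrable lborel g"
    using int[of 0] by (simp add: set_integrable_def g_def)
  then have [measurable]: "g \<in> borel_measurable borel"
    by (simp add: borel_measurable_integrable)
  define a where "a = (\<lambda>k. (\<integral>t. g t * of_real (ln t) ^ k \<partial>lborel) / fact k)"
  have "(\<lambda>k. a k * s ^ k) sums ?E s" for s
  proof -
    let ?f = "\<lambda>k t. g t * ((s * of_real (ln t)) ^ k / fact k)"
    \<comment> \<open>The majorant is the norm of the integrand at the real point |s|, hence
      integrable by assumption. It is the sum of the norms of all terms of the exponential series,
      since ln t > 0 wherever g is nonzero.\<close>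
    let ?B = "\<lambda>t. norm (g t) * exp (norm s * ln t)"
    have g0: "g t = 0" if "t \<le> 1" for t
      using that by (simp add: g_def)
    have exp_eq: "g t * exp (z * of_real (ln t)) = indicator {1<..} t *\<^sub>R (\<phi> t * of_real t powr (z - 1))" for t z
      by (auto simp: g_def indicator_def powr_def exp_diff exp_minus field_simps Ln_of_real simp flip: exp_add)
    have B: "integrable lborel ?B"
    proof -
      have "integrable lborel (\<lambda>t. norm (g t * exp (of_real (norm s) * of_real (ln t))))"
        using int[of "of_real (norm s)"] unfolding exp_eq set_integrable_def by (rule integrable_norm)
      then show ?thesis
        by (simp add: norm_mult)
    qed
    have nf: "norm (?f k t) = norm (g t) * ((norm s * ln t) ^ k / fact k)" for k t
    proof (cases "t > 1")
      case True
      then show ?thesis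
        by (simp add: norm_mult norm_divide norm_power)
    qed (simp add: g0)
    have sumB: "(\<lambda>k. norm (?f k t)) sums ?B t" for t
      unfolding nf using exp_converges[of "norm s * ln t"]
      by (intro sums_mult) (simp add: divide_inverse_commute)
    have partial: "(\<Sum>k\<in>A. norm (?f k t)) \<le> ?B t" if "finite A" for A t
      using sumB[of t] sum_le_suminf[of "\<lambda>k. norm (?f k t)" A] that
      by (auto simp: sums_iff)
    have intf: "integrable lborel (?f k)" for k
    proof (rule Bochner_Integration.integrable_bound[OF B])
      show "?f k \<in> borel_measurable lborel" by measurable
      show "AE t in lborel. norm (?f k t) \<le> norm (?B t)"
        using partial[of "{k}"] by (intro AE_I2) (auto simp: abs_mult)
    qed
    have "(\<lambda>k. integral\<^sup>L lborel (?f k)) sums (\<integral>t. (\<Sum>k. ?f k t) \<partial>lborel)"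
    proof (rule sums_integral[OF intf])
      show "AE t in lborel. summable (\<lambda>k. norm (?f k t))"
        using sumB by (auto simp: sums_iff)
      show "summable (\<lambda>k. \<integral>t. norm (?f k t) \<partial>lborel)"
      proof (rule summableI_nonneg_bounded)
        fix n
        have "(\<Sum>k<n. \<integral>t. norm (?f k t) \<partial>lborel) = (\<integral>t. (\<Sum>k<n. norm (?f k t)) \<partial>lborel)"
          using intf by (intro Bochner_Integration.integral_sum[symmetric] integrable_norm)
        also have "\<dots> \<le> integral\<^sup>L lborel ?B"
          using intf B partial
          by (intro integral_mono Bochner_Integration.integrable_sum integrable_norm) auto
        finally show "(\<Sum>k<n. \<integral>t. norm (?f k t) \<partial>lborel) \<le> integral\<^sup>L lborel ?B" .
      qed auto
    qed
    also have "(\<lambda>k. integral\<^sup>L lborel (?f k)) = (\<lambda>k. a k * s ^ k)"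
    proof
      fix k
      have "integral\<^sup>L lborel (?f k) = (\<integral>t. g t * of_real (ln t) ^ k * (s ^ k / fact k) \<partial>lborel)"
        by (intro Bochner_Integration.integral_cong) (auto simp: power_mult_distrib field_simps)
      then show "integral\<^sup>L lborel (?f k) = a k * s ^ k"
        by (simp add: a_def)
    qed
    also have "(\<lambda>t. \<Sum>k. ?f k t) = (\<lambda>t. indicator {1<..} t *\<^sub>R (\<phi> t * of_real t powr (s - 1)))"
    proof
      fix t
      have "(\<lambda>k. ?f k t) sums (g t * exp (s * of_real (ln t)))"
        using exp_converges[of "s * of_real (ln t)"]
        by (intro sums_mult) (simp add: scaleR_conv_of_real divide_inverse_commute)
      then show "(\<Sum>k. ?f k t) = indicator {1<..} t *\<^sub>R (\<phi> t * of_real t powr (s - 1))"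
        unfolding exp_eq by (simp add: sums_iff)
    qed
    finally show ?thesis
      by (simp add: set_lebesgue_integral_def)
  qed
  then have "?E analytic_on ball 0 r" for r
    by (intro power_series_analytic[where a = a]) simp
  then show ?thesis
    by (metis (no_types, lifting) UNIV_I analytic_on_def mem_ball_0 gt_ex)
qed

section \<open>Integrals over the half-line beyond 1\<close>

text \<open>The weight 1/t^2 is the Jacobian of t \<mapsto> 1/t, which carries the half-line beyond
  1 onto the interval between 0 and 1; the point 1 is a null set.\<close>

lemma set_integral_Ioi_inversion:
  fixes f :: "real \<Rightarrow> 'a::euclidean_space"
  assumes f: "set_integrable lborel {0<..} f"
  shows "(LBINT t:{0<..}. f t) = (LBINT t:{1<..}. f t) + (LBINT t:{1<..}. (1 / t\<^sup>2) *\<^sub>R f (1 / t))"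
proof -
  let ?g = "\<lambda>t. (1 / t\<^sup>2) *\<^sub>R f (1 / t)"
  have f01: "set_integrable lborel {0<..<1} f" and f1: "set_integrable lborel {1<..} f"
    by (rule set_integrable_subset[OF f]; auto)+
  have abs01: "f absolutely_integrable_on {0<..<1}"
    using f01 unfolding set_integrable_def
    by (subst integrable_completion) (simp_all add: borel_measurable_integrable)
  have img: "(\<lambda>t. 1 / t) ` {1<..} = {0<..<1::real}"
    by (auto simp: image_iff intro!: bexI[of _ "1 / _"])
  have der: "((\<lambda>t. 1 / t) has_field_derivative - (1 / t\<^sup>2)) (at t within {1<..})" if "t \<in> {1<..}" for t :: real
    using that by (auto intro!: derivative_eq_intros simp: power2_eq_square)
  have inj: "inj_on (\<lambda>t. 1 / t) {1::real<..}"
    by (auto simp: inj_on_def)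
  have "(\<lambda>t. \<bar>- (1 / t\<^sup>2)\<bar> *\<^sub>R f (1 / t)) absolutely_integrable_on {1<..} \<and>
      integral {1<..} (\<lambda>t. \<bar>- (1 / t\<^sup>2)\<bar> *\<^sub>R f (1 / t)) = integral {0<..<1} f"
    using has_absolute_integral_change_of_variables_real[OF _ der inj, of f "integral {0<..<1} f"] abs01
    by (simp add: img)
  then have g: "?g absolutely_integrable_on {1<..}" "integral {1<..} ?g = integral {0<..<1} f"
    by simp_all
  have "(\<lambda>x. indicator {0<..<1} x *\<^sub>R f x) \<in> borel_measurable borel"
    using f01 unfolding set_integrable_def by (simp add: borel_measurable_integrable)
  then have [measurable]: "(\<lambda>t. indicator {0<..<1} (1 / t) *\<^sub>R f (1 / t)) \<in> borel_measurable borel"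
    by measurable
  \<comment> \<open>Only f cut off to the open unit interval is known to be measurable; the inverted
    integrand is its composition with t \<mapsto> 1/t.\<close>
  have eq: "indicator {1<..} t *\<^sub>R ?g t = (1 / t\<^sup>2) *\<^sub>R (indicator {0<..<1} (1 / t) *\<^sub>R f (1 / t))" for t
    by (auto simp: indicator_def)
  have "(\<lambda>t. indicator {1<..} t *\<^sub>R ?g t) \<in> borel_measurable borel"
    unfolding eq by measurable
  with g(1) have sg: "set_integrable lborel {1<..} ?g"
    by (rule set_integrable_lborel_if_absolutely_integrable)
  have "(LBINT t:{1<..}. ?g t) = (LBINT t:{0<..<1}. f t)"
    using set_borel_integral_eq_integral(2)[OF sg] set_borel_integral_eq_integral(2)[OF f01] g(2) by simp
  moreover have "(LBINT t:{0<..}. f t) = (LBINT t:{0<..<1} \<union> {1<..}. f t)"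
    unfolding set_lebesgue_integral_def
  proof (rule integral_cong_AE)
    show "(\<lambda>x. indicat_real {0<..} x *\<^sub>R f x) \<in> borel_measurable lborel"
      using f unfolding set_integrable_def by (rule borel_measurable_integrable)
    show "(\<lambda>x. indicat_real ({0<..<1} \<union> {1<..}) x *\<^sub>R f x) \<in> borel_measurable lborel"
      using set_integrable_Un[OF f01 f1] unfolding set_integrable_def
      by (intro borel_measurable_integrable) auto
    show "AE x in lborel. indicat_real {0<..} x *\<^sub>R f x = indicat_real ({0<..<1} \<union> {1<..}) x *\<^sub>R f x"
      using AE_lborel_singleton[of 1] by eventually_elim (auto simp: indicator_def)
  qed
  moreover have "\<dots> = (LBINT t:{0<..<1}. f t) + (LBINT t:{1<..}. f t)"
    by (rule set_integral_Un) (use f01 f1 in auto)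
  ultimately show "(LBINT t:{0<..}. f t) = (LBINT t:{1<..}. f t) + (LBINT t:{1<..}. ?g t)"
    by simp
qed

lemma set_integrable_powr_Ioi_real:
  assumes "a > 1"
  shows "set_integrable lborel {1<..} (\<lambda>t :: real. t powr (- a))"
    and "set_integrable lborel {1<..} (\<lambda>t :: real. ln t * t powr (- a))"
proof -
  have *: "set_integrable lborel {1<..} (\<lambda>t :: real. t powr (- b))" if "b > 1" for b
  proof -
    have "((\<lambda>t. t powr (- b)) has_integral - (1 powr (- b + 1)) / (- b + 1)) {1::real..}"
      using that by (intro has_integral_powr_to_inf) auto
    then have "((\<lambda>t. t powr (- b)) has_integral - (1 powr (- b + 1)) / (- b + 1)) {1::real<..}"
      by (subst has_integral_spike_set_eq[of _ "{1..}"]) (auto intro: negligible_subset[of "{1}"])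
    then show ?thesis
      by (rule set_integrable_lborel_if_nonneg) auto
  qed
  then show "set_integrable lborel {1<..} (\<lambda>t :: real. t powr (- a))"
    using assms .
  \<comment> \<open>Half of the margin a - 1 is given to the logarithm through ln t \<le> t^e /
    e.\<close>
  define e where "e = (a - 1) / 2"
  have e: "e > 0" "a - e > 1" using assms by (auto simp: e_def field_simps)
  have "set_integrable lborel {1<..} (\<lambda>t :: real. 1 / e * t powr (- (a - e)))"
    by (intro set_integrable_mult_right * e)
  then show "set_integrable lborel {1<..} (\<lambda>t :: real. ln t * t powr (- a))"
    unfolding set_integrable_def
  proof (rule Bochner_Integration.integrable_bound)
    show "AE t in lborel. norm (indicator {1<..} t *\<^sub>R (ln t * t powr (- a)))
        \<le> norm (indicator {1<..} t *\<^sub>R (1 / e * t powr (- (a - e))))"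
    proof (intro AE_I2)
      fix t :: real
      show "norm (indicator {1<..} t *\<^sub>R (ln t * t powr (- a)))
        \<le> norm (indicator {1<..} t *\<^sub>R (1 / e * t powr (- (a - e))))"
      proof (cases "t > 1")
        case True
        have "ln t * t powr (- a) \<le> t powr e / e * t powr (- a)"
          using True e by (intro mult_right_mono ln_powr_bound) auto
        also have "\<dots> = 1 / e * t powr (- (a - e))"
          by (simp flip: powr_add)
        finally show ?thesis using True e by simp
      qed auto
    qed
  qed measurable
qed

text \<open>With w = z - 1 the antiderivatives are -t^(-w)/w and -(ln t) * t^(-w)/w - t^(-w)/w^2.
  Both vanish at infinity, so the values come from t = 1, where the logarithm vanishes too.\<close>

lemma has_bochner_integral_powr_Ioi:
  fixes z :: complex
  assumes z: "Re z > 1"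
  shows "has_bochner_integral lborel (\<lambda>t. indicator {1<..} t *\<^sub>R (of_real t powr (- z))) (1 / (z - 1))"
    and "has_bochner_integral lborel (\<lambda>t. indicator {1<..} t *\<^sub>R (of_real (ln t) * of_real t powr (- z)))
           (1 / (z - 1)\<^sup>2)"
proof -
  define w where "w = z - 1"
  have w: "Re w > 0" "w \<noteq> 0" using z by (auto simp: w_def)
  have zw: "- z = - w - 1" by (simp add: w_def)
  have einter: "einterval 1 \<infinity> = {1::real<..}"
    by (auto simp: einterval_def one_ereal_def)
  have ge: "t > 1" if "1 < ereal t" for t
    using that by (simp add: one_ereal_def)
  have int1: "set_integrable lborel {1<..} (\<lambda>t. of_real t powr (- z) :: complex)"
    using set_integrable_powr_Ioi_real(1)[OF z] unfolding set_integrable_def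
    by (rule Bochner_Integration.integrable_bound) (auto simp: indicator_def norm_powr_real_powr)
  have int2: "set_integrable lborel {1<..} (\<lambda>t. of_real (ln t) * of_real t powr (- z) :: complex)"
    using set_integrable_powr_Ioi_real(2)[OF z] unfolding set_integrable_def
    by (rule Bochner_Integration.integrable_bound) (auto simp: indicator_def norm_powr_real_powr norm_mult)
  have lim1: "((\<lambda>t. of_real t powr (- w) :: complex) \<longlongrightarrow> 0) at_top"
    using w by (intro tendsto_neg_powr_complex_of_real filterlim_ident) auto
  have "isCont (\<lambda>t. of_real t powr (- w) :: complex) 1"
    by (intro continuous_intros) auto
  then have lim3: "((\<lambda>t. of_real t powr (- w) :: complex) \<longlongrightarrow> 1) (at_right 1)"
    by (auto simp: isCont_def intro: tendsto_mono[OF at_le])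
  have "isCont (\<lambda>t. of_real (ln t) * of_real t powr (- w) :: complex) 1"
    by (intro continuous_intros) auto
  then have lim4: "((\<lambda>t. of_real (ln t) * of_real t powr (- w) :: complex) \<longlongrightarrow> 0) (at_right 1)"
    by (auto simp: isCont_def intro: tendsto_mono[OF at_le])
  have lim2: "((\<lambda>t. of_real (ln t) * of_real t powr (- w) :: complex) \<longlongrightarrow> 0) at_top"
  proof (rule Lim_null_comparison)
    define r where "r = Re w / 2"
    have r: "r > 0" using w by (simp add: r_def)
    show "eventually (\<lambda>t. norm (of_real (ln t) * of_real t powr (- w) :: complex) \<le> 1 / r * t powr (- r)) at_top"
      using eventually_ge_at_top[of 1]
    proof eventually_elim
      case (elim t)
      have "norm (of_real (ln t) * of_real t powr (- w) :: complex) = ln t * t powr (- Re w)"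
        using elim by (simp add: norm_mult norm_powr_real_powr)
      also have "\<dots> \<le> t powr r / r * t powr (- Re w)"
        using elim r by (intro mult_right_mono ln_powr_bound) auto
      also have "\<dots> = 1 / r * t powr (- r)"
        by (simp add: r_def flip: powr_add)
      finally show ?case .
    qed
    show "((\<lambda>t. 1 / r * t powr (- r)) \<longlongrightarrow> 0) at_top"
      using r by (intro tendsto_mult_right_zero tendsto_neg_powr filterlim_ident) auto
  qed
  have nonpos: "of_real t \<notin> \<real>\<^sub>\<le>\<^sub>0" if "t > 1" for t :: real
    using that by (auto simp: complex_nonpos_Reals_iff)
  have "(LBINT t=1..\<infinity>. of_real t powr (- z)) = 0 - (- 1 / w)"
  proof (rule interval_integral_FTC_integrable)
    let ?F = "\<lambda>t. - (of_real t powr (- w)) / w :: complex"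
    show "(?F has_vector_derivative of_real t powr (- z)) (at t)" if "1 < ereal t" for t
      using w nonpos[OF ge[OF that]]
      by (intro has_vector_derivative_real_field) (auto intro!: derivative_eq_intros simp: zw field_simps)
    show "isCont (\<lambda>t. of_real t powr (- z) :: complex) t" if "1 < ereal t" for t
      using nonpos[OF ge[OF that]] by (intro continuous_intros) auto
    show "((?F \<circ> real_of_ereal) \<longlongrightarrow> - 1 / w) (at_right 1)"
      unfolding one_ereal_def ereal_tendsto_simps
      using tendsto_divide[OF tendsto_minus[OF lim3] tendsto_const w(2)] by simp
    show "((?F \<circ> real_of_ereal) \<longlongrightarrow> 0) (at_left \<infinity>)"
      unfolding ereal_tendsto_simps
      using tendsto_divide[OF tendsto_minus[OF lim1] tendsto_const w(2)] by simp
  qed (use int1 in \<open>auto simp: einter\<close>)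
  then have "(LBINT t:{1<..}. of_real t powr (- z)) = 1 / w"
    by (simp add: one_ereal_def interval_integral_to_infinity_eq)
  then show "has_bochner_integral lborel (\<lambda>t. indicator {1<..} t *\<^sub>R (of_real t powr (- z))) (1 / (z - 1))"
    using int1 by (simp add: has_bochner_integral_iff set_integrable_def set_lebesgue_integral_def w_def)
  have "(LBINT t=1..\<infinity>. of_real (ln t) * of_real t powr (- z)) = 0 - (- 1 / w\<^sup>2)"
  proof (rule interval_integral_FTC_integrable)
    \<comment> \<open>\<open>?G\<close> is the antiderivative with the complex logarithm, to which
      the complex derivative rules apply; it agrees with \<open>?F\<close> on positive
      reals.\<close>
    let ?G = "\<lambda>s. - (Ln s * s powr (- w)) / w - s powr (- w) / w\<^sup>2 :: complex"
    let ?F = "\<lambda>t. - (of_real (ln t) * of_real t powr (- w)) / w - of_real t powr (- w) / w\<^sup>2 :: complex"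
    show "(?F has_vector_derivative of_real (ln t) * of_real t powr (- z)) (at t)" if t: "1 < ereal t" for t
    proof -
      note t' = ge[OF t] nonpos[OF ge[OF t]]
      have "((\<lambda>t. ?G (of_real t)) has_vector_derivative of_real (ln t) * of_real t powr (- z)) (at t)"
        using w t' by (intro has_vector_derivative_real_field)
          (auto intro!: derivative_eq_intros simp: zw Ln_of_real powr_diff powr_minus field_simps power2_eq_square)
      then show ?thesis
      proof (rule has_vector_derivative_transform_within_open[where S = "{0<..}"])
        show "?G (of_real s) = ?F s" if "s \<in> {0<..}" for s
          using that by (simp add: Ln_of_real)
      qed (use t' in auto)
    qed
    show "isCont (\<lambda>t. of_real (ln t) * of_real t powr (- z) :: complex) t" if "1 < ereal t" for t
      using ge[OF that] nonpos[OF ge[OF that]] by (intro continuous_intros) auto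
    show "((?F \<circ> real_of_ereal) \<longlongrightarrow> - 1 / w\<^sup>2) (at_right 1)"
      unfolding one_ereal_def ereal_tendsto_simps
      using tendsto_diff[OF tendsto_divide[OF tendsto_minus[OF lim4] tendsto_const w(2)]
        tendsto_divide[OF lim3 tendsto_const[of "w\<^sup>2"]]] w by simp
    show "((?F \<circ> real_of_ereal) \<longlongrightarrow> 0) (at_left \<infinity>)"
      unfolding ereal_tendsto_simps
      using tendsto_diff[OF tendsto_divide[OF tendsto_minus[OF lim2] tendsto_const w(2)]
        tendsto_divide[OF lim1 tendsto_const[of "w\<^sup>2"]]] w by simp
  qed (use int2 in \<open>auto simp: einter\<close>)
  then have "(LBINT t:{1<..}. of_real (ln t) * of_real t powr (- z)) = 1 / w\<^sup>2"
    by (simp add: one_ereal_def interval_integral_to_infinity_eq)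
  then show "has_bochner_integral lborel (\<lambda>t. indicator {1<..} t *\<^sub>R (of_real (ln t) * of_real t powr (- z)))
      (1 / (z - 1)\<^sup>2)"
    using int2 by (simp add: has_bochner_integral_iff set_integrable_def set_lebesgue_integral_def w_def)
qed

section \<open>The Mellin representation of the completed L-function\<close>

text \<open>The sign e lets one lemma serve both the coefficients at positive and those at negative
  frequencies.\<close>

lemma poly_growth_coeffs_nat:
  assumes "poly_growth_coeffs S a" and "\<And>n. e * int (Suc n) \<in> S" and "\<bar>e\<bar> = 1"
  obtains C k where "\<And>n. norm (a (e * int (Suc n))) \<le> C * real (Suc n) ^ k"
proof -
  obtain C k where *: "\<And>n. n \<in> S \<Longrightarrow> norm (a n) \<le> C * \<bar>of_int n\<bar> ^ k"
    using assms(1) by (auto simp: poly_growth_coeffs_def)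
  have "\<bar>real_of_int (e * int (Suc n))\<bar> = real (Suc n)" for n
    using assms(3) by (metis abs_mult abs_of_nat mult_1 of_int_abs of_int_of_nat_eq)
  with *[OF assms(2)] show ?thesis
    by (intro that[of C k]) metis
qed

lemma infsum_Suc:
  fixes f :: "'i \<Rightarrow> 'a::banach"
  assumes bij: "bij_betw (\<lambda>n. g (Suc n)) UNIV S" and "summable (\<lambda>n. norm (f (g (Suc n))))"
  shows "infsum f S = (\<Sum>n. f (g (Suc n)))"
proof -
  have "((\<lambda>n. f (g (Suc n))) has_sum (\<Sum>n. f (g (Suc n)))) UNIV"
    using assms(2) by (intro norm_summable_imp_has_sum summable_sums[OF summable_norm_cancel])
  then have "(f has_sum (\<Sum>n. f (g (Suc n)))) S"
    using has_sum_reindex_bij_betw[OF bij, of f] by simp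
  then show ?thesis
    by (rule infsumI)
qed

lemma bij_betw_positive_int: "bij_betw (\<lambda>n. int (Suc n)) UNIV {0<..}"
proof (rule bij_betw_byWitness[where f' = "\<lambda>i. nat (i - 1)"])
qed auto

lemma bij_betw_negative_int: "bij_betw (\<lambda>n. - int (Suc n)) UNIV {..<0}"
proof (rule bij_betw_byWitness[where f' = "\<lambda>i. nat (- i - 1)"])
qed auto

lemma bij_betw_positive_nat: "bij_betw Suc UNIV {1..}"
proof (rule bij_betw_byWitness[where f' = "\<lambda>i. i - 1"])
qed auto

lemma summable_on_norm_Suc:
  fixes f :: "nat \<Rightarrow> 'a::real_normed_vector"
  shows "(\<lambda>n. norm (f n)) summable_on {1..} \<longleftrightarrow> summable (\<lambda>n. norm (f (Suc n)))"
  using summable_on_reindex_bij_betw[OF bij_betw_positive_nat, of "\<lambda>n. norm (f n)"]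
  by (simp add: summable_on_UNIV_nonneg_real_iff)

lemma of_real_powr_reciprocal:
  assumes "x > 0" "y > 0" "x * y = 1"
  shows "of_real x powr s = (of_real y powr (- s) :: complex)"
proof -
  have "ln x = - ln y"
    using assms by (metis add_eq_0_iff2 ln_mult_pos ln_one)
  with assms show ?thesis
    by (simp add: powr_def Ln_of_real)
qed

text \<open>The nonconstant part of the expansion at \<tau> = i t / sqrt N. With x = 2 pi |n| t /
  sqrt N, the argument 4 |n| v is 2x / pi, while q^n is exp (-x) for n > 0 and exp x for n <
  0.\<close>

definition fourier_tail :: "nat \<Rightarrow> fourier_coeffs \<Rightarrow> real \<Rightarrow> complex" where
  "fourier_tail N A t =
     kernel_sum (\<lambda>x. exp (- x)) (\<lambda>n. c_coeff A (int (Suc n))) (2 * pi / sqrt N * t) +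
     kernel_sum (\<lambda>x. beta (2 * x / pi) * exp x) (\<lambda>n. b_coeff A (- int (Suc n))) (2 * pi / sqrt N * t) +
     kernel_sum (\<lambda>x. alpha (2 * x / pi) * exp (- x)) (\<lambda>n. a_coeff A (int (Suc n))) (2 * pi / sqrt N * t)"

lemma has_fourier_expansionE:
  assumes "has_fourier_expansion F A"
  obtains C1 k1 C2 k2 C3 k3 where
    "\<And>n. norm (c_coeff A (int (Suc n))) \<le> C1 * real (Suc n) ^ k1"
    "\<And>n. norm (b_coeff A (- int (Suc n))) \<le> C2 * real (Suc n) ^ k2"
    "\<And>n. norm (a_coeff A (int (Suc n))) \<le> C3 * real (Suc n) ^ k3"
proof -
  have g: "poly_growth_coeffs {0<..} (c_coeff A)" "poly_growth_coeffs {..<0} (b_coeff A)"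
    "poly_growth_coeffs {0<..} (a_coeff A)"
    using assms by (simp_all add: has_fourier_expansion_def)
  obtain C1 k1 where 1: "\<And>n. norm (c_coeff A (1 * int (Suc n))) \<le> C1 * real (Suc n) ^ k1"
    by (rule poly_growth_coeffs_nat[OF g(1), of 1]) auto
  obtain C2 k2 where 2: "\<And>n. norm (b_coeff A (- 1 * int (Suc n))) \<le> C2 * real (Suc n) ^ k2"
    by (rule poly_growth_coeffs_nat[OF g(2), of "- 1"]) auto
  obtain C3 k3 where 3: "\<And>n. norm (a_coeff A (1 * int (Suc n))) \<le> C3 * real (Suc n) ^ k3"
    by (rule poly_growth_coeffs_nat[OF g(3), of 1]) auto
  show ?thesis
    using 1 2 3 by (intro that[of C1 k1 C2 k2 C3 k3]) simp_all
qed

lemma fourier_expansion_imaginary_axis: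
  assumes A: "has_fourier_expansion F A" and N: "N > 0" and t: "t > 0"
  shows "F (\<i> * of_real (t / sqrt N)) = d_coeff A 0 + d_coeff A 1 * of_real (ln t - ln (sqrt N)) +
    d_coeff A 2 * of_real (real N powr (- 1/4) * sqrt t) + fourier_tail N A t"
proof -
  obtain C1 k1 C2 k2 C3 k3 where bnd:
    "\<And>n. norm (c_coeff A (int (Suc n))) \<le> C1 * real (Suc n) ^ k1"
    "\<And>n. norm (b_coeff A (- int (Suc n))) \<le> C2 * real (Suc n) ^ k2"
    "\<And>n. norm (a_coeff A (int (Suc n))) \<le> C3 * real (Suc n) ^ k3"
    using has_fourier_expansionE[OF A] by metis
  define v where "v = t / sqrt N"
  have v: "v > 0" using t N by (simp add: v_def)
  define x where "x = 2 * pi / sqrt N * t"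
  have x: "x > 0" "x = 2 * pi * v" using t N by (simp_all add: x_def v_def)
  define \<tau> where "\<tau> = \<i> * complex_of_real v"
  have Im: "Im \<tau> = v" by (simp add: \<tau>_def)
  have "qq \<tau> = of_real (exp (- x))"
    by (simp add: qq_def \<tau>_def x(2) exp_of_real[symmetric] mult_ac)
  then have q: "qq \<tau> powi (int (Suc n)) = of_real (exp (- (real (Suc n) * x)))"
      "qq \<tau> powi (- int (Suc n)) = of_real (exp (real (Suc n) * x))" for n
    by (simp_all add: power_int_minus exp_minus power_inverse algebra_simps
        flip: exp_of_nat_mult of_real_power of_real_inverse del: of_nat_Suc power_Suc)
  have arg: "4 * of_int (int (Suc n)) * Im \<tau> = 2 * (real (Suc n) * x) / pi"
    "- 4 * of_int (- int (Suc n)) * Im \<tau> = 2 * (real (Suc n) * x) / pi" for n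
    by (simp_all add: Im x(2))
  let ?f = "\<lambda>n. c_coeff A n * qq \<tau> powi n"
  have fe: "?f (int (Suc n)) = c_coeff A (int (Suc n)) * of_real (exp (- (real (Suc n) * x)))" for n
    by (simp only: q)
  have 1: "(\<Sum>\<^sub>\<infinity>n\<in>{0<..}. ?f n) =
      kernel_sum (\<lambda>x. exp (- x)) (\<lambda>n. c_coeff A (int (Suc n))) x"
    by (subst infsum_Suc[OF bij_betw_positive_int])
      (use summable_kernel_sum[OF decaying_exp bnd(1) x(1)] in \<open>simp_all only: fe kernel_sum_def\<close>)
  let ?g = "\<lambda>n. b_coeff A n * of_real (beta (- 4 * of_int n * Im \<tau>)) * qq \<tau> powi n"
  have ge: "?g (- int (Suc n)) = b_coeff A (- int (Suc n)) *
      of_real (beta (2 * (real (Suc n) * x) / pi) * exp (real (Suc n) * x))" for n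
    unfolding arg q of_real_mult by (rule mult.assoc)
  have 2: "(\<Sum>\<^sub>\<infinity>n\<in>{..<0}. ?g n) =
      kernel_sum (\<lambda>x. beta (2 * x / pi) * exp x) (\<lambda>n. b_coeff A (- int (Suc n))) x"
    by (subst infsum_Suc[OF bij_betw_negative_int])
      (use summable_kernel_sum[OF decaying_beta bnd(2) x(1)] in \<open>simp_all only: ge kernel_sum_def\<close>)
  let ?h = "\<lambda>n. a_coeff A n * of_real (alpha (4 * of_int n * Im \<tau>)) * qq \<tau> powi n"
  have he: "?h (int (Suc n)) = a_coeff A (int (Suc n)) *
      of_real (alpha (2 * (real (Suc n) * x) / pi) * exp (- (real (Suc n) * x)))" for n
    unfolding arg q of_real_mult by (rule mult.assoc)
  have 3: "(\<Sum>\<^sub>\<infinity>n\<in>{0<..}. ?h n) =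
      kernel_sum (\<lambda>x. alpha (2 * x / pi) * exp (- x)) (\<lambda>n. a_coeff A (int (Suc n))) x"
    by (subst infsum_Suc[OF bij_betw_positive_int])
      (use summable_kernel_sum[OF decaying_alpha bnd(3) x(1)] in \<open>simp_all only: he kernel_sum_def\<close>)
  have "\<tau> \<in> \<H>" using v by (simp add: Im)
  with A have "F \<tau> = d_coeff A 0 + d_coeff A 1 * of_real (ln (Im \<tau>)) + d_coeff A 2 * of_real (sqrt (Im \<tau>))
      + (\<Sum>\<^sub>\<infinity>n\<in>{0<..}. ?f n) + (\<Sum>\<^sub>\<infinity>n\<in>{..<0}. ?g n) + (\<Sum>\<^sub>\<infinity>n\<in>{0<..}. ?h n)"
    unfolding has_fourier_expansion_def by blast
  moreover have "ln (Im \<tau>) = ln t - ln (sqrt N)"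
    using t N by (simp add: Im v_def ln_div)
  moreover have "sqrt (Im \<tau>) = real N powr (- 1/4) * sqrt t"
    using t N by (simp add: Im v_def real_sqrt_divide powr_minus field_simps powr_powr flip: powr_half_sqrt)
  ultimately show ?thesis
    unfolding 1 2 3 fourier_tail_def by (simp add: \<tau>_def v_def x_def)
qed

lemma Gamma_eq_LBINT:
  assumes "Re s > 0"
  shows "(LBINT x:{0<..}. of_real (exp (- x)) * of_real x powr (s - 1)) = (Gamma s :: complex)"
proof -
  let ?f = "\<lambda>t. complex_of_real t powr (s - 1) / of_real (exp t)"
  have "set_integrable lborel {0<..} ?f"
    using absolutely_integrable_Gamma_integral'[OF assms]
    by (rule set_integrable_lborel_if_absolutely_integrable) measurable
  from set_borel_integral_eq_integral(2)[OF this] have "(LBINT x:{0<..}. ?f x) = Gamma s"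
    using Gamma_integral_complex'[OF assms] by (simp add: integral_unique)
  then show ?thesis
    by (simp add: exp_minus divide_inverse_commute)
qed

lemma W_integrand_eq_beta:
  "W_integrand s x = of_real (sqrt pi) * (of_real (beta (2 * x / pi) * exp x) * of_real x powr (s - 1))"
proof -
  have "inc_Gamma (1/2) (2 * x) = sqrt pi * beta (2 * x / pi)"
    by (simp add: inc_Gamma_def beta_def mult.commute)
  then show ?thesis
    by (simp add: W_integrand_def)
qed

text \<open>All three series are rescaled by the same r = 2 pi / sqrt N, and r^(-s) is the prefactor
  of \<open>Lambda\<close>. The factor 1 / sqrt pi in front of \<open>W_half\<close> normalises the
  incomplete Gamma function to \<open>beta\<close>.\<close>

lemma Lambda_eq_mellin:
  assumes A: "has_fourier_expansion F A" and N: "N > 0"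
  obtains \<sigma> where "\<And>s. Re s > \<sigma> \<Longrightarrow> Lambda_defined A s \<and>
      set_integrable lborel {0<..} (\<lambda>t. fourier_tail N A t * of_real t powr (s - 1)) \<and>
      Lambda N A s = (LBINT t:{0<..}. fourier_tail N A t * of_real t powr (s - 1))"
proof -
  obtain C1 k1 C2 k2 C3 k3 where bnd:
    "\<And>n. norm (c_coeff A (int (Suc n))) \<le> C1 * real (Suc n) ^ k1"
    "\<And>n. norm (b_coeff A (- int (Suc n))) \<le> C2 * real (Suc n) ^ k2"
    "\<And>n. norm (a_coeff A (int (Suc n))) \<le> C3 * real (Suc n) ^ k3"
    using has_fourier_expansionE[OF A] by metis
  define r where "r = 2 * pi / sqrt N"
  have r: "r > 0" using N by (simp add: r_def)
  \<comment> \<open>The largest of the three growth exponents decides; the added 1 makes the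
    Dirichlet series converge and also places s to the right of 1.\<close>
  define \<sigma> where "\<sigma> = real (max k1 (max k2 k3)) + 1"
  have main: "Lambda_defined A s \<and>
      set_integrable lborel {0<..} (\<lambda>t. fourier_tail N A t * of_real t powr (s - 1)) \<and>
      Lambda N A s = (LBINT t:{0<..}. fourier_tail N A t * of_real t powr (s - 1))"
    if "Re s > \<sigma>" for s
  proof -
    have s: "Re s > real k1 + 1" "Re s > real k2 + 1" "Re s > real k3 + 1" "Re s > 1"
      using that by (auto simp: \<sigma>_def)
    note mc = mellin_kernel_sum[OF decaying_exp bnd(1) r s(1)]
    note mb = mellin_kernel_sum[OF decaying_beta bnd(2) r s(2)]
    note ma = mellin_kernel_sum[OF decaying_alpha bnd(3) r s(3)]
    have Z: "set_integrable lborel {0<..} (Z_integrand s)"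
      using decaying_mellin_integrable[OF decaying_alpha s(4)] by (simp add: Z_integrand_def[abs_def])
    have W: "set_integrable lborel {0<..} (W_integrand s)"
      unfolding W_integrand_eq_beta[abs_def]
      using decaying_mellin_integrable[OF decaying_beta s(4)] by (rule set_integrable_mult_right)
    have "Lambda_defined A s"
      unfolding Lambda_defined_def summable_on_norm_Suc L_plus_term_def L_minus_term_def L_star_term_def
      using mc(1) mb(1) ma(1) Z W by blast
    moreover have tail: "fourier_tail N A t * of_real t powr (s - 1) =
        kernel_sum (\<lambda>x. exp (- x)) (\<lambda>n. c_coeff A (int (Suc n))) (r * t) * of_real t powr (s - 1) +
        kernel_sum (\<lambda>x. beta (2 * x / pi) * exp x) (\<lambda>n. b_coeff A (- int (Suc n))) (r * t) * of_real t powr (s - 1) +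
        kernel_sum (\<lambda>x. alpha (2 * x / pi) * exp (- x)) (\<lambda>n. a_coeff A (int (Suc n))) (r * t) * of_real t powr (s - 1)" for t
      by (simp add: fourier_tail_def r_def distrib_right)
    have "set_integrable lborel {0<..} (\<lambda>t. fourier_tail N A t * of_real t powr (s - 1))"
      unfolding tail using mc(2) mb(2) ma(2) by (intro set_integral_add(1))
    moreover have "Lambda N A s = (LBINT t:{0<..}. fourier_tail N A t * of_real t powr (s - 1))"
    proof -
      have "L_plus A s = (\<Sum>n. c_coeff A (int (Suc n)) * of_nat (Suc n) powr (- s))"
        unfolding L_plus_def L_plus_term_def using mc(1)
        by (subst infsum_Suc[where g = id]) (simp_all add: bij_betw_positive_nat[simplified] del: of_nat_Suc)
      moreover have "L_minus A s = (\<Sum>n. b_coeff A (- int (Suc n)) * of_nat (Suc n) powr (- s))"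
        unfolding L_minus_def L_minus_term_def using mb(1)
        by (subst infsum_Suc[where g = id]) (simp_all add: bij_betw_positive_nat[simplified] del: of_nat_Suc)
      moreover have "L_star A s = (\<Sum>n. a_coeff A (int (Suc n)) * of_nat (Suc n) powr (- s))"
        unfolding L_star_def L_star_term_def using ma(1)
        by (subst infsum_Suc[where g = id]) (simp_all add: bij_betw_positive_nat[simplified] del: of_nat_Suc)
      moreover have "of_real (sqrt N / (2 * pi)) powr s = (of_real r powr (- s) :: complex)"
        using r N by (intro of_real_powr_reciprocal) (simp_all add: r_def)
      moreover have "Gamma s = (LBINT x:{0<..}. of_real (exp (- x)) * of_real x powr (s - 1))"
        using s(4) by (intro Gamma_eq_LBINT[symmetric]) simp
      moreover have "1 / of_real (sqrt pi) * W_half s =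
          (LBINT x:{0<..}. of_real (beta (2 * x / pi) * exp x) * of_real x powr (s - 1))"
        by (simp add: W_half_def W_integrand_eq_beta)
      moreover have "Z_int s = (LBINT x:{0<..}. of_real (alpha (2 * x / pi) * exp (- x)) * of_real x powr (s - 1))"
        by (simp add: Z_int_def Z_integrand_def)
      moreover have "(LBINT t:{0<..}. fourier_tail N A t * of_real t powr (s - 1)) =
        (LBINT t:{0<..}. kernel_sum (\<lambda>x. exp (- x)) (\<lambda>n. c_coeff A (int (Suc n))) (r * t) * of_real t powr (s - 1)) +
        (LBINT t:{0<..}. kernel_sum (\<lambda>x. beta (2 * x / pi) * exp x) (\<lambda>n. b_coeff A (- int (Suc n))) (r * t) * of_real t powr (s - 1)) +
        (LBINT t:{0<..}. kernel_sum (\<lambda>x. alpha (2 * x / pi) * exp (- x)) (\<lambda>n. a_coeff A (int (Suc n))) (r * t) * of_real t powr (s - 1))"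
        unfolding tail using mc(2) mb(2) ma(2) by (simp add: set_integral_add)
      ultimately show ?thesis
        unfolding Lambda_def mc(3) mb(3) ma(3) by (simp only: distrib_left mult_ac)
    qed
    ultimately show ?thesis by blast
  qed
  show ?thesis
    using main by (rule that)
qed

section \<open>The Hecke split and its poles\<close>

text \<open>f is g w / (w - z)^2 with g analytic, and its residue is g'(z) = a. Allowing a or b to
  vanish covers simple poles and removable points as well, so the same lemma settles all four
  exceptional points.\<close>

lemma double_pole_resI:
  assumes h: "h analytic_on {z}"
    and f: "eventually (\<lambda>w. f w = h w + a / (w - z) + b / (w - z)\<^sup>2) (at z)"
  shows "double_pole_res (b \<noteq> 0) f z a"
proof -
  obtain S where S: "open S" "z \<in> S" "h holomorphic_on S"
    using h by (auto simp: analytic_at)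
  define g where "g = (\<lambda>w. h w * (w - z)\<^sup>2 + a * (w - z) + b)"
  have g: "g holomorphic_on S"
    unfolding g_def by (intro holomorphic_intros S)
  have ne: "eventually (\<lambda>w. w \<noteq> z) (at z)"
    by (simp add: eventually_at_filter)
  have fg: "eventually (\<lambda>w. f w = g w / (w - z)\<^sup>2) (at z)"
    using f ne by eventually_elim (simp add: g_def add_divide_distrib power2_eq_square)
  have h': "(h has_field_derivative deriv h z) (at z)"
    using S by (simp add: holomorphic_derivI)
  have "(g has_field_derivative a) (at z)"
    unfolding g_def by (rule derivative_eq_intros h' refl | simp)+
  then have dg: "deriv g z = a"
    by (rule DERIV_imp_deriv)
  have "residue f z = residue (\<lambda>w. g w / (w - z) ^ Suc 1) z"
    using fg by (intro residue_cong) (simp_all add: numeral_2_eq_2)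
  also have "\<dots> = a"
    by (subst residue_holomorphic_over_power[OF S(1,2) g]) (simp add: dg)
  finally have res: "residue f z = a" .
  show ?thesis
  proof (cases "b = 0")
    case False
    have "is_pole (\<lambda>w. g w / (w - z)\<^sup>2) z"
      using False by (intro is_pole_basic[OF g S(1,2)]) (auto simp: g_def)
    then have "is_pole f z"
      using is_pole_cong[OF fg refl] by simp
    moreover have "zorder f z = zorder (\<lambda>w. g w / (w - z)\<^sup>2) z"
      using fg by (intro zorder_cong) auto
    moreover have "\<dots> = - 2"
      using False by (intro zorder_eqI[OF S(1,2) g])
        (auto simp: g_def power_int_minus field_simps)
    ultimately show ?thesis
      using res False by (simp add: double_pole_res_def double_pole_def)
  next
    case b: True
    define k where "k = (\<lambda>w. h w * (w - z) + a)"
    have k: "k holomorphic_on S"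
      unfolding k_def by (intro holomorphic_intros S)
    have fk: "eventually (\<lambda>w. f w = k w / (w - z) ^ 1) (at z)"
      using f ne by eventually_elim (simp add: k_def b field_simps)
    show ?thesis
    proof (cases "a = 0")
      case False
      have "is_pole (\<lambda>w. k w / (w - z) ^ 1) z"
        using False by (intro is_pole_basic[OF k S(1,2)]) (auto simp: k_def)
      then have "is_pole f z"
        using is_pole_cong[OF fk refl] by simp
      moreover have "zorder f z = zorder (\<lambda>w. k w / (w - z) ^ 1) z"
        using fk by (intro zorder_cong) auto
      moreover have "\<dots> = - 1"
        using False by (intro zorder_eqI[OF S(1,2) k])
          (auto simp: k_def power_int_minus field_simps)
      ultimately show ?thesis
        using res False b by (simp add: double_pole_res_def simple_pole_res_def simple_pole_def)
    next
      case True
      have "eventually (\<lambda>w. f w = h w) (at z)"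
        using f ne by eventually_elim (simp add: b True)
      then have "is_pole f z \<longleftrightarrow> is_pole h z"
        by (intro is_pole_cong) auto
      with h have "\<not> is_pole f z"
        by (simp add: analytic_at_imp_no_pole)
      then show ?thesis
        using res b True by (simp add: double_pole_res_def simple_pole_res_def)
    qed
  qed
qed

definition tail_integral :: "nat \<Rightarrow> fourier_coeffs \<Rightarrow> complex \<Rightarrow> complex" where
  "tail_integral N A s = (LBINT t:{1<..}. fourier_tail N A t * of_real t powr (s - 1))"

text \<open>The Hecke split: the two tail integrals are entire, and the remaining terms are the Mellin
  integrals over \<open>{1<..}\<close> of the constant terms of the two expansions.\<close>

definition Lambda_split :: "nat \<Rightarrow> fourier_coeffs \<Rightarrow> fourier_coeffs \<Rightarrow> complex \<Rightarrow> complex \<Rightarrow> complex" where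
  "Lambda_split N A B w s = tail_integral N A s + w * tail_integral N B (1/2 - s)
     + (- d_coeff A 0 + d_coeff A 1 * of_real (ln (sqrt N))) / s + d_coeff A 1 / s\<^sup>2
     + - of_real (real N powr (- 1/4)) * d_coeff A 2 / (s + 1/2)
     + w * (d_coeff B 0 - d_coeff B 1 * of_real (ln (sqrt N))) / (s - 1/2) + w * d_coeff B 1 / (s - 1/2)\<^sup>2
     + w * of_real (real N powr (- 1/4)) * d_coeff B 2 / (s - 1)"

text \<open>The Mellin representation gives integrability far to the right; on t > 1 it passes to
  every s further left.\<close>

lemma set_integrable_fourier_tail:
  assumes A: "has_fourier_expansion F A" and N: "N > 0"
  shows "set_integrable lborel {1<..} (\<lambda>t. fourier_tail N A t * of_real t powr (s - 1))"
proof -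
  obtain \<sigma> where \<sigma>: "\<And>s. Re s > \<sigma> \<Longrightarrow>
      set_integrable lborel {0<..} (\<lambda>t. fourier_tail N A t * of_real t powr (s - 1))"
    using Lambda_eq_mellin[OF A N] by metis
  define z where "z = complex_of_real (max (Re s) (\<sigma> + 1))"
  have "Re z > \<sigma>" "Re s \<le> Re z" by (auto simp: z_def)
  have "set_integrable lborel {1<..} (\<lambda>t. fourier_tail N A t * of_real t powr (z - 1))"
    by (rule set_integrable_subset[OF \<sigma>[OF \<open>Re z > \<sigma>\<close>]]) auto
  then show ?thesis
    using \<open>Re s \<le> Re z\<close> by (rule set_integrable_mellin_tail)
qed

lemma tail_integral_analytic:
  assumes "has_fourier_expansion F A" and "N > 0"
  shows "tail_integral N A analytic_on UNIV"
  unfolding tail_integral_def[abs_def]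
  by (rule holomorphic_mellin_tail) (rule set_integrable_fourier_tail[OF assms])

text \<open>The pointwise algebra of the split in abstract letters: p is t^(-s), q is sqrt t, l is
  ln t, L is ln (sqrt N), M is N^(-1/4), and T is the tail of G at t. In these letters (1/t)^(s-1)
  is p * (q * q) and t^2 is q^4, so no power laws remain.\<close>

lemma Lambda_split_integrand:
  fixes q :: complex
  assumes "q \<noteq> 0"
  shows "w * (T * (p / q)) + (w * (b0 - b1 * L) * (p / q) + w * b1 * (l * (p / q)) + w * M * b2 * p)
      + ((- a0 + a1 * L) * (p / (q * q)) + a1 * (l * (p / (q * q))) + - M * a2 * (p / (q * q * q)))
    = (w * q * (b0 + b1 * (l - L) + b2 * (M * q) + T) - (a0 + a1 * (- l - L) + a2 * (M * (1 / q))))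
      * (p * (q * q)) / (q * q * (q * q))"
  using assms by (simp add: field_simps)

lemma Lambda_eq_split:
  assumes A: "has_fourier_expansion F A" and B: "has_fourier_expansion G B" and N: "N > 0"
    and FG: "\<And>t. t > 0 \<Longrightarrow> F (\<i> * of_real (1 / t / sqrt N)) = w * of_real (sqrt t) * G (\<i> * of_real (t / sqrt N))"
  obtains \<sigma> where "\<And>s. Re s > \<sigma> \<Longrightarrow> Lambda_defined A s \<and> Lambda N A s = Lambda_split N A B w s"
proof -
  obtain \<sigma> where mellin: "\<And>s. Re s > \<sigma> \<Longrightarrow> Lambda_defined A s \<and>
      set_integrable lborel {0<..} (\<lambda>t. fourier_tail N A t * of_real t powr (s - 1)) \<and>
      Lambda N A s = (LBINT t:{0<..}. fourier_tail N A t * of_real t powr (s - 1))"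
    using Lambda_eq_mellin[OF A N] by blast
  then have \<sigma>: "Lambda_defined A s"
    "set_integrable lborel {0<..} (\<lambda>t. fourier_tail N A t * of_real t powr (s - 1))"
    "Lambda N A s = (LBINT t:{0<..}. fourier_tail N A t * of_real t powr (s - 1))"
    if "Re s > \<sigma>" for s
    using that by blast+
  let ?L = "complex_of_real (ln (sqrt N))" and ?M = "complex_of_real (real N powr (- 1/4))"
  have "Lambda N A s = Lambda_split N A B w s" if s: "Re s > max \<sigma> 2" for s
  proof -
    let ?I = "\<lambda>t. indicator {1<..} t :: real"
    \<comment> \<open>For z = s + 1/2, s, s + 1 and s + 3/2, the values z - 1 are the denominators
      of the split.\<close>
    have pw: "has_bochner_integral lborel (\<lambda>t. ?I t *\<^sub>R (of_real t powr (- (s + 1/2)))) (1 / (s - 1/2))"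
      "has_bochner_integral lborel (\<lambda>t. ?I t *\<^sub>R (of_real (ln t) * of_real t powr (- (s + 1/2)))) (1 / (s - 1/2)\<^sup>2)"
      "has_bochner_integral lborel (\<lambda>t. ?I t *\<^sub>R (of_real t powr (- s))) (1 / (s - 1))"
      "has_bochner_integral lborel (\<lambda>t. ?I t *\<^sub>R (of_real t powr (- (s + 1)))) (1 / s)"
      "has_bochner_integral lborel (\<lambda>t. ?I t *\<^sub>R (of_real (ln t) * of_real t powr (- (s + 1)))) (1 / s\<^sup>2)"
      "has_bochner_integral lborel (\<lambda>t. ?I t *\<^sub>R (of_real t powr (- (s + 3/2)))) (1 / (s + 1/2))"
      using has_bochner_integral_powr_Ioi[of "s + 1/2"] has_bochner_integral_powr_Ioi[of s]
        has_bochner_integral_powr_Ioi[of "s + 1"] has_bochner_integral_powr_Ioi[of "s + 3/2"] s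
      by (simp_all add: algebra_simps)
    have tB: "has_bochner_integral lborel
        (\<lambda>t. ?I t *\<^sub>R (fourier_tail N B t * of_real t powr ((1/2 - s) - 1))) (tail_integral N B (1/2 - s))"
      using set_integrable_fourier_tail[OF B N, of "1/2 - s"]
      by (simp add: has_bochner_integral_iff set_integrable_def tail_integral_def set_lebesgue_integral_def)
    let ?R = "w * tail_integral N B (1/2 - s)
      + (w * (d_coeff B 0 - d_coeff B 1 * ?L) * (1 / (s - 1/2)) + w * d_coeff B 1 * (1 / (s - 1/2)\<^sup>2)
         + w * ?M * d_coeff B 2 * (1 / (s - 1)))
      + ((- d_coeff A 0 + d_coeff A 1 * ?L) * (1 / s) + d_coeff A 1 * (1 / s\<^sup>2)
         + - ?M * d_coeff A 2 * (1 / (s + 1/2)))"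
    let ?r = "\<lambda>t. w * (?I t *\<^sub>R (fourier_tail N B t * of_real t powr ((1/2 - s) - 1)))
      + (w * (d_coeff B 0 - d_coeff B 1 * ?L) * (?I t *\<^sub>R (of_real t powr (- (s + 1/2))))
         + w * d_coeff B 1 * (?I t *\<^sub>R (of_real (ln t) * of_real t powr (- (s + 1/2))))
         + w * ?M * d_coeff B 2 * (?I t *\<^sub>R (of_real t powr (- s))))
      + ((- d_coeff A 0 + d_coeff A 1 * ?L) * (?I t *\<^sub>R (of_real t powr (- (s + 1))))
         + d_coeff A 1 * (?I t *\<^sub>R (of_real (ln t) * of_real t powr (- (s + 1))))
         + - ?M * d_coeff A 2 * (?I t *\<^sub>R (of_real t powr (- (s + 3/2)))))"
    have "has_bochner_integral lborel ?r ?R"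
      by (intro has_bochner_integral_add has_bochner_integral_mult_right tB pw)
    moreover have "?r t = ?I t *\<^sub>R ((1 / t\<^sup>2) *\<^sub>R (fourier_tail N A (1 / t) * of_real (1 / t) powr (s - 1)))" for t
    proof (cases "t > 1")
      case True
      define p where "p = complex_of_real t powr (- s)"
      define q where "q = complex_of_real (sqrt t)"
      have q: "q * q = of_real t" "q \<noteq> 0" "complex_of_real t \<noteq> 0"
        using True by (simp_all add: q_def flip: of_real_mult)
      have half: "complex_of_real t powr (1/2) = q"
        using True powr_of_real[of t "1/2"] by (simp add: q_def powr_half_sqrt)
      have e: "complex_of_real t powr ((1/2 - s) - 1) = p / q" "complex_of_real t powr (- (s + 1/2)) = p / q"
        "complex_of_real t powr (- (s + 1)) = p / (q * q)" "complex_of_real t powr (- (s + 3/2)) = p / (q * q * q)"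
      proof -
        have half': "complex_of_real t powr (z - 1/2) = of_real t powr z / q"
          and one: "complex_of_real t powr (z - 1) = of_real t powr z / (q * q)" for z
          using q by (simp_all add: powr_diff half)
        have exps: "(1/2 - s) - 1 = - s - 1/2" "- (s + 1/2) = - s - 1/2" "- (s + 1) = - s - 1"
          "- (s + 3/2) = - s - 1 - 1/2"
          by simp_all
        show "complex_of_real t powr ((1/2 - s) - 1) = p / q" "complex_of_real t powr (- (s + 1/2)) = p / q"
          "complex_of_real t powr (- (s + 1)) = p / (q * q)" "complex_of_real t powr (- (s + 3/2)) = p / (q * q * q)"
          unfolding exps half' one p_def by (simp_all add: mult.assoc)
      qed
      have inv: "complex_of_real (1 / t) powr (s - 1) = p * (q * q)"
        using True by (subst of_real_powr_reciprocal[of _ t]) (simp_all add: powr_diff powr_minus p_def q(1) divide_inverse mult.commute)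
      \<comment> \<open>The expansion of F at 1/t is solved for its tail, then F is replaced through
        the relation with G. The constant terms of F thus enter with a minus sign, and ln (1/t) = -
        ln t restores a plus sign for its logarithm.\<close>
      have "fourier_tail N A (1 / t) = F (\<i> * of_real (1 / t / sqrt N))
          - (d_coeff A 0 + d_coeff A 1 * of_real (ln (1 / t) - ln (sqrt N)) + d_coeff A 2 * (?M * (1 / q)))"
        using fourier_expansion_imaginary_axis[OF A N, of "1 / t"] True
        by (simp add: real_sqrt_divide q_def)
      also have "F (\<i> * of_real (1 / t / sqrt N)) = w * q * (d_coeff B 0 + d_coeff B 1 * of_real (ln t - ln (sqrt N))
          + d_coeff B 2 * (?M * q) + fourier_tail N B t)"
        using fourier_expansion_imaginary_axis[OF B N, of t] FG[of t] True by (simp add: q_def)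
      finally have tail: "fourier_tail N A (1 / t) = w * q * (d_coeff B 0 + d_coeff B 1 * (of_real (ln t) - ?L)
          + d_coeff B 2 * (?M * q) + fourier_tail N B t)
          - (d_coeff A 0 + d_coeff A 1 * (- of_real (ln t) - ?L) + d_coeff A 2 * (?M * (1 / q)))"
        using True by (simp add: ln_div)
      have t2: "(1 / t\<^sup>2) *\<^sub>R x = x / (q * q * (q * q))" for x :: complex
        by (simp add: scaleR_conv_of_real power2_eq_square q(1))
      have I: "?I t = 1" using True by simp
      show ?thesis
        unfolding I scaleR_one e inv t2 tail p_def[symmetric] by (rule Lambda_split_integrand[OF q(2)])
    qed auto
    ultimately have "(LBINT t:{1<..}. (1 / t\<^sup>2) *\<^sub>R (fourier_tail N A (1 / t) * of_real (1 / t) powr (s - 1))) = ?R"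
      by (simp add: set_lebesgue_integral_def has_bochner_integral_iff)
    then have "Lambda N A s = tail_integral N A s + ?R"
      using set_integral_Ioi_inversion[OF \<sigma>(2)[of s]] \<sigma>(3)[of s] s by (simp add: tail_integral_def)
    then show ?thesis
      by (simp only: Lambda_split_def times_divide_eq_right mult_1_right add_ac)
  qed
  with \<sigma>(1) show ?thesis
    by (intro that[of "max \<sigma> 2"]) auto
qed

text \<open>Reflection exchanges the two tail integrals, s with s - 1/2, and s + 1/2 with s - 1,
  each linear denominator changing its sign. The coefficients of the simple fractions of A and B
  have opposite signs, which compensates; the squared denominators and their coefficients show no
  sign at all.\<close>

lemma Lambda_split_functional_equation:
  assumes "w * v = 1"
  shows "Lambda_split N A B w s = w * Lambda_split N B A v (1/2 - s)"
proof -
  have neg: "x / y = - (x / z)" if "y = - z" for x y z :: complex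
    using that by simp
  have 1: "x / (1/2 - s + 1/2) = - (x / (s - 1))" "x / (1/2 - s - 1/2) = - (x / s)"
    "x / (1/2 - s - 1) = - (x / (s + 1/2))" "x / (1/2 - s) = - (x / (s - 1/2))" for x
    by (rule neg, simp)+
  have sq: "(1/2 - s - 1/2)\<^sup>2 = s\<^sup>2" "(1/2 - s)\<^sup>2 = (s - 1/2)\<^sup>2"
    by (simp_all add: power2_commute)
  have 2: "w * (v * x) = x" for x
    using assms by (simp flip: mult.assoc)
  have 3: "1/2 - (1/2 - s) = s" by simp
  show ?thesis
    unfolding Lambda_split_def 1 sq 3
    by (simp only: divide_inverse ring_distribs mult_minus_left mult_minus_right minus_add_distrib
        mult.assoc 2 minus_minus add_ac diff_conv_add_uminus)
qed

lemma Lambda_split_singularities: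
  fixes w :: complex
  assumes A: "has_fourier_expansion F A" and B: "has_fourier_expansion G B" and N: "N > 0"
  defines "\<Lambda> \<equiv> remove_sings (Lambda_split N A B w)"
  shows "\<Lambda> nicely_meromorphic_on UNIV"
    and "s \<notin> {- 1/2, 0, 1/2, 1} \<Longrightarrow> \<Lambda> s = Lambda_split N A B w s"
    and "{s. is_pole \<Lambda> s} \<subseteq> {- 1/2, 0, 1/2, 1}"
    and "simple_pole_res \<Lambda> (- 1/2) (- of_real (real N powr (- 1/4)) * d_coeff A 2)"
    and "simple_pole_res \<Lambda> 1 (w * of_real (real N powr (- 1/4)) * d_coeff B 2)"
    and "double_pole_res (d_coeff A 1 \<noteq> 0) \<Lambda> 0 (- d_coeff A 0 + d_coeff A 1 * of_real (ln (sqrt (real N))))"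
    and "double_pole_res (w * d_coeff B 1 \<noteq> 0) \<Lambda> (1/2) (w * (d_coeff B 0 - d_coeff B 1 * of_real (ln (sqrt (real N)))))"
proof -
  \<comment> \<open>The entire part. At each exceptional point it is joined by the fractions
    belonging to the other three points to form the analytic summand of
    \<open>double_pole_resI\<close>.\<close>
  define e where "e = (\<lambda>s. tail_integral N A s + w * tail_integral N B (1/2 - s))"
  have tA: "tail_integral N A holomorphic_on UNIV" and tB: "tail_integral N B holomorphic_on UNIV"
    using tail_integral_analytic[OF A N] tail_integral_analytic[OF B N]
    by (simp_all add: analytic_on_open)
  have "(tail_integral N B \<circ> (\<lambda>s. 1/2 - s)) holomorphic_on UNIV"
    by (intro holomorphic_on_compose_gen[OF _ tB] holomorphic_intros) auto
  then have "e holomorphic_on UNIV"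
    unfolding e_def o_def by (intro holomorphic_intros tA)
  then have e: "e analytic_on S" for S
    by (meson analytic_on_open analytic_on_subset open_UNIV subset_UNIV)
  define a0 b0 a1 a2 b2 a3
    where "a0 = - d_coeff A 0 + d_coeff A 1 * of_real (ln (sqrt N))" and "b0 = d_coeff A 1"
      and "a1 = - of_real (real N powr (- 1/4)) * d_coeff A 2"
      and "a2 = w * (d_coeff B 0 - d_coeff B 1 * of_real (ln (sqrt N)))" and "b2 = w * d_coeff B 1"
      and "a3 = w * of_real (real N powr (- 1/4)) * d_coeff B 2"
  note defs = a0_def b0_def a1_def a2_def b2_def a3_def
  have split: "Lambda_split N A B w = (\<lambda>s. e s + a0 / s + b0 / s\<^sup>2 + a1 / (s + 1/2)
      + a2 / (s - 1/2) + b2 / (s - 1/2)\<^sup>2 + a3 / (s - 1))"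
    by (simp only: Lambda_split_def[abs_def] e_def defs)
  have mero: "Lambda_split N A B w meromorphic_on UNIV"
    unfolding split by (intro meromorphic_intros analytic_on_imp_meromorphic_on[OF e])
  show "\<Lambda> nicely_meromorphic_on UNIV"
    unfolding \<Lambda>_def using mero by (rule remove_sings_nicely_meromorphic)
  have ana: "Lambda_split N A B w analytic_on {s}" if "s \<notin> {- 1/2, 0, 1/2, 1}" for s
    unfolding split using that by (intro analytic_intros e) (auto simp: add_eq_0_iff2)
  then show "\<Lambda> s = Lambda_split N A B w s" if "s \<notin> {- 1/2, 0, 1/2, 1}"
    unfolding \<Lambda>_def using that by (intro remove_sings_at_analytic)
  have ev: "eventually (\<lambda>s. \<Lambda> s = Lambda_split N A B w s) (at z)" for z
    unfolding \<Lambda>_def using mero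
    by (intro eventually_remove_sings_eq_at meromorphic_on_isolated_singularity) (auto intro: meromorphic_on_subset)
  show "{s. is_pole \<Lambda> s} \<subseteq> {- 1/2, 0, 1/2, 1}"
  proof
    fix s assume "s \<in> {s. is_pole \<Lambda> s}"
    then have "is_pole (Lambda_split N A B w) s"
      using is_pole_cong[OF ev refl] by simp
    then show "s \<in> {- 1/2, 0, 1/2, 1}"
      using ana analytic_at_imp_no_pole by blast
  qed
  \<comment> \<open>With double-pole coefficient 0 the predicate reduces to
    \<open>simple_pole_res\<close>.\<close>
  have "double_pole_res ((0 :: complex) \<noteq> 0) \<Lambda> (- 1/2) a1"
  proof (rule double_pole_resI)
    show "(\<lambda>s. e s + a0 / s + b0 / s\<^sup>2 + a2 / (s - 1/2) + b2 / (s - 1/2)\<^sup>2 + a3 / (s - 1)) analytic_on {- 1/2}"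
      by (intro analytic_intros e) auto
  qed (use ev[of "- 1/2"] in eventually_elim, simp add: split)
  then show "simple_pole_res \<Lambda> (- 1/2) (- of_real (real N powr (- 1/4)) * d_coeff A 2)"
    by (simp add: double_pole_res_def a1_def)
  have "double_pole_res ((0 :: complex) \<noteq> 0) \<Lambda> 1 a3"
  proof (rule double_pole_resI)
    show "(\<lambda>s. e s + a0 / s + b0 / s\<^sup>2 + a1 / (s + 1/2) + a2 / (s - 1/2) + b2 / (s - 1/2)\<^sup>2) analytic_on {1}"
      by (intro analytic_intros e) auto
  qed (use ev[of 1] in eventually_elim, simp add: split)
  then show "simple_pole_res \<Lambda> 1 (w * of_real (real N powr (- 1/4)) * d_coeff B 2)"
    by (simp add: double_pole_res_def a3_def)
  have "double_pole_res (b0 \<noteq> 0) \<Lambda> 0 a0"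
  proof (rule double_pole_resI)
    show "(\<lambda>s. e s + a1 / (s + 1/2) + a2 / (s - 1/2) + b2 / (s - 1/2)\<^sup>2 + a3 / (s - 1)) analytic_on {0}"
      by (intro analytic_intros e) auto
  qed (use ev[of 0] in eventually_elim, simp add: split)
  then show "double_pole_res (d_coeff A 1 \<noteq> 0) \<Lambda> 0 (- d_coeff A 0 + d_coeff A 1 * of_real (ln (sqrt (real N))))"
    by (simp only: a0_def b0_def)
  have "double_pole_res (b2 \<noteq> 0) \<Lambda> (1/2) a2"
  proof (rule double_pole_resI)
    show "(\<lambda>s. e s + a0 / s + b0 / s\<^sup>2 + a1 / (s + 1/2) + a3 / (s - 1)) analytic_on {1/2}"
      by (intro analytic_intros e) (auto simp: complex_eq_iff)
  qed (use ev[of "1/2"] in eventually_elim, simp add: split)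
  then show "double_pole_res (w * d_coeff B 1 \<noteq> 0) \<Lambda> (1/2) (w * (d_coeff B 0 - d_coeff B 1 * of_real (ln (sqrt (real N)))))"
    by (simp only: a2_def b2_def)
qed

section \<open>Continuation, Fricke relation and functional equation\<close>

lemma remove_sings_mult_const:
  assumes "w \<noteq> 0"
  shows "remove_sings (\<lambda>s. w * f s) z = w * remove_sings f z"
proof (cases "\<exists>c. f \<midarrow>z\<rightarrow> c")
  case True
  then obtain c where c: "f \<midarrow>z\<rightarrow> c" ..
  then have "(\<lambda>s. w * f s) \<midarrow>z\<rightarrow> w * c"
    by (rule tendsto_mult_left)
  with c show ?thesis
    by (metis remove_sings_eqI)
next
  \<comment> \<open>Without a limit \<open>remove_sings\<close> has the default value 0.
    Multiplication by the inverse of w shows that the scaled function has no limit either, so both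
    sides are 0.\<close>
  case False
  moreover have "\<nexists>c. (\<lambda>s. w * f s) \<midarrow>z\<rightarrow> c"
    using False assms tendsto_mult_left[where c = "inverse w" and f = "\<lambda>s. w * f s"]
    by (force simp flip: mult.assoc)
  ultimately show ?thesis
    by (simp add: remove_sings_def)
qed

lemma Lambda_continuation_split:
  assumes "has_fourier_expansion F A" and "has_fourier_expansion G B" and "N > 0"
    and "\<And>t. t > 0 \<Longrightarrow> F (\<i> * of_real (1 / t / sqrt N)) = w * of_real (sqrt t) * G (\<i> * of_real (t / sqrt N))"
  shows "Lambda_continuation N A (remove_sings (Lambda_split N A B w))"
proof -
  obtain \<sigma> where \<sigma>: "\<And>s. Re s > \<sigma> \<Longrightarrow> Lambda_defined A s \<and> Lambda N A s = Lambda_split N A B w s"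
    using Lambda_eq_split[OF assms] by metis
  \<comment> \<open>All exceptional points have real part at most 1; to the right of it
    \<open>remove_sings\<close> changes nothing.\<close>
  have "Re s \<le> 1" if "s \<in> {- 1/2, 0, 1/2, 1}" for s :: complex
    using that by (elim insertE) (auto simp: complex_eq_iff)
  then have "Lambda_defined A s \<and> remove_sings (Lambda_split N A B w) s = Lambda N A s" if "Re s > max \<sigma> 1" for s
    using that \<sigma>[of s] Lambda_split_singularities(2)[OF assms(1-3), of s w] by fastforce
  then show ?thesis
    unfolding Lambda_continuation_def using Lambda_split_singularities(1)[OF assms(1-3)] by blast
qed

text \<open>N * (i t / sqrt N) is i times the positive real sqrt N * t, so the principal power
  splits into N^(-1/4) * t^(-1/2) * i^(-1/2). Here N^(-1/4) cancels the normalisation of the Fricke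
  operator, and solving for F inverts the other two factors.\<close>

lemma fricke_imaginary_axis:
  assumes "N > 0" and "t > 0"
  shows "F (\<i> * of_real (1 / t / sqrt N)) =
    \<i> powr (1/2) * of_real (sqrt t) * fricke N F (\<i> * of_real (t / sqrt N))"
proof -
  have NN: "sqrt N * sqrt N = N" "sqrt N > 0"
    using assms by simp_all
  have eq: "of_nat N * (\<i> * of_real (t / sqrt N)) = of_real (sqrt N * t) * \<i>"
  proof -
    have "of_nat N = complex_of_real (sqrt N) * of_real (sqrt N)"
      using NN by (metis of_real_mult of_real_of_nat_eq)
    then show ?thesis
      using NN by (simp add: field_simps)
  qed
  have root: "(sqrt N * t) powr (- 1/2) = 1 / (real N powr (1/4) * sqrt t)"
  proof -
    have "sqrt N powr (- 1/2) = (real N powr (1/2)) powr (- 1/2)"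
      by (simp only: powr_half_sqrt of_nat_0_le_iff)
    also have "\<dots> = 1 / real N powr (1/4)"
      by (simp add: powr_powr powr_minus_divide)
    finally have "sqrt N powr (- 1/2) = 1 / real N powr (1/4)" .
    moreover have "t powr (- 1/2) = 1 / sqrt t"
      using assms by (simp add: powr_minus_divide powr_half_sqrt)
    ultimately show ?thesis
      using assms by (simp add: powr_mult)
  qed
  have "complex_of_real (sqrt N * t) powr of_real (- 1/2) = of_real ((sqrt N * t) powr (- 1/2))"
    using assms by (intro powr_of_real) simp
  then have root': "complex_of_real (sqrt N * t) powr (- 1/2) = of_real (1 / (real N powr (1/4) * sqrt t))"
    unfolding root by simp
  have pw: "(of_real (sqrt N * t) * \<i>) powr (- 1/2) =
      of_real (1 / (real N powr (1/4) * sqrt t)) * \<i> powr (- 1/2)"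
    using assms by (subst powr_times_real_left) (simp_all only: root', auto)
  have arg: "- 1 / (of_real (sqrt N * t) * \<i>) = \<i> * of_real (1 / t / sqrt N)"
    by (simp add: divide_inverse)
  have i: "\<i> powr (1/2) * \<i> powr (- 1/2) = 1"
    by (simp flip: powr_add)
  show ?thesis
    unfolding fricke_def eq pw arg using assms i by (simp add: field_simps)
qed

theorem theorem1p1:
  fixes N :: nat and chi :: "int \<Rightarrow> complex" and F G :: "complex \<Rightarrow> complex"
    and CF CG :: fourier_coeffs
  assumes "N > 0" and "4 dvd N" and "dirichlet_character N chi"
    and "F \<in> Vmg_half N chi"
    and "G = fricke N F"
    and "has_fourier_expansion F CF"
    and "has_fourier_expansion G CG"
  shows "\<exists>\<Lambda>F \<Lambda>G. Lambda_continuation N CF \<Lambda>F \<and> Lambda_continuation N CG \<Lambda>G \<and>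
    {s. is_pole \<Lambda>F s} \<subseteq> {- 1/2, 0, 1/2, 1} \<and>
    simple_pole_res \<Lambda>F (- 1/2) (- of_real (real N powr (- 1/4)) * d_coeff CF 2) \<and>
    simple_pole_res \<Lambda>F 1 (\<i> powr (1/2) * of_real (real N powr (- 1/4)) * d_coeff CG 2) \<and>
    double_pole_res (d_coeff CF 1 \<noteq> 0) \<Lambda>F 0
      (- d_coeff CF 0 + d_coeff CF 1 * of_real (ln (sqrt (real N)))) \<and>
    double_pole_res (d_coeff CG 1 \<noteq> 0) \<Lambda>F (1/2)
      (\<i> powr (1/2) * (d_coeff CG 0 - d_coeff CG 1 * of_real (ln (sqrt (real N))))) \<and>
    (\<forall>s. \<Lambda>F s = \<i> powr (1/2) * \<Lambda>G (1/2 - s))"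
proof -
  define w :: complex where "w = \<i> powr (1/2)"
  have w: "w \<noteq> 0" by (simp add: w_def)
  have FG: "F (\<i> * of_real (1 / t / sqrt N)) = w * of_real (sqrt t) * G (\<i> * of_real (t / sqrt N))"
    if "t > 0" for t
    using fricke_imaginary_axis[OF assms(1) that] by (simp only: w_def assms(5))
  \<comment> \<open>This is \<open>FG\<close> at 1/t solved for G, which gives the inverse constant
    1 / w without applying the Fricke operator a second time.\<close>
  have GF: "G (\<i> * of_real (1 / t / sqrt N)) = 1 / w * of_real (sqrt t) * F (\<i> * of_real (t / sqrt N))"
    if "t > 0" for t
  proof -
    have "F (\<i> * of_real (t / sqrt N)) = w * of_real (sqrt (1 / t)) * G (\<i> * of_real (1 / t / sqrt N))"
      using FG[of "1 / t"] that by simp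
    then show ?thesis
      using w that by (simp add: real_sqrt_divide)
  qed
  let ?\<Lambda>F = "remove_sings (Lambda_split N CF CG w)" and ?\<Lambda>G = "remove_sings (Lambda_split N CG CF (1 / w))"
  have "?\<Lambda>F s = w * ?\<Lambda>G (1/2 - s)" for s
  proof -
    have "Lambda_split N CF CG w = (\<lambda>s. w * (Lambda_split N CG CF (1 / w) \<circ> (\<lambda>s. 1/2 - s)) s)"
      using Lambda_split_functional_equation[of w "1 / w" N CF CG] w by (auto simp: fun_eq_iff)
    \<comment> \<open>The reflection maps punctured neighbourhoods of s to those of 1/2 - s, so
      \<open>remove_sings\<close> commutes with it and the identity of the splits carries over to
      every s, poles included.\<close>
    moreover have fm: "filtermap (\<lambda>s. 1/2 - s) (at s) = at (1/2 - s)"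
    proof (rule filtermap_fun_inverse[where g = "\<lambda>s. 1/2 - s"])
      have flip: "filterlim (\<lambda>s. 1/2 - s) (at (1/2 - z)) (at z)" for z :: complex
        by (intro filterlim_atI tendsto_intros) (simp add: eventually_at_filter)
      show "filterlim (\<lambda>s. 1/2 - s) (at (1/2 - s)) (at s)"
        by (rule flip)
      show "filterlim (\<lambda>s. 1/2 - s) (at s) (at (1/2 - s))"
        using flip[of "1/2 - s"] by simp
    qed simp
    ultimately show ?thesis
      by (simp only: remove_sings_mult_const[OF w] remove_sings_compose[OF fm])
  qed
  \<comment> \<open>As w is nonzero, the condition \<open>w * d_coeff CG 1 \<noteq> 0\<close> for a
    double pole at 1/2 becomes \<open>d_coeff CG 1 \<noteq> 0\<close>.\<close>
  then show ?thesis
    using Lambda_continuation_split[OF assms(6,7,1) FG] Lambda_continuation_split[OF assms(7,6,1) GF]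
      Lambda_split_singularities(3-7)[OF assms(6,7,1), of w] w
    unfolding w_def by (intro exI[of _ ?\<Lambda>F] exI[of _ ?\<Lambda>G]) (simp add: w_def)
qed

end
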